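(* Let $(w,r)\in\Gamma$. Then (1) $\mathrm{rdcWrd}(w,r)$ is a rich word; (2) $T(\mathrm{rdcWrd}(w,r))\subseteq T(w)$; (3) $\mathrm{occur}(\mathrm{rdcWrd}(w,r),r)<\mathrm{occur}(w,r)$; (4) $|\mathrm{lcp}(\mathrm{rdcWrd}(w,r),w)|\ge |r|-1$; (5) $|\mathrm{lcs}(\mathrm{rdcWrd}(w,r),w)|\ge |r|-1$.
   Context: Words are finite words over a finite alphabet $A$, including the empty word $\epsilon$. $F(w)$, $\mathrm{Prf}(w)$, $\mathrm{Suf}(w)$ denote the sets of all (contiguous) factors, prefixes, suffixes of $w$ (each containing $\epsilon$ and $w$); $w^R$ is the reversal of $w$. A word of length $n$ has at most $n+1$ distinct palindromic factors (counting $\epsilon$); it is rich if it has exactly $n+1$. $R$ is the set of rich words over $A$. $\mathrm{lps}(w)$, $\mathrm{lpp}(w)$ are the longest palindromic suffix and prefix of $w$; $\mathrm{lpps}(w)$ (for $|w|\ge2$) is the longest proper palindromic suffix of $w$. $\mathrm{rtrim}(w)$, $\mathrm{ltrim}(w)$ are obtained from a nonempty $w$ by deleting its last, respectively first, letter. $\mathrm{occur}(u,v)$ is the number of occurrences of the nonempty word $v$ in $u$. $\mathrm{lcp}$, $\mathrm{lcs}$ denote the longest common prefix and longest common suffix of two words. The palindromic closure is $\mathrm{pc}(w)=uvu^R$, where $w=uv$ and $v=\mathrm{lps}(w)$. A factor $g$ of a word is a complete return to $r$ if $g$ contains exactly two occurrences of $r$, one as a prefix and one as a suffix. Standard extension: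 for $w\in R$ with $|w|\ge 2$, $\mathrm{StdExt}(w,0)=w$; $\mathrm{StdExt}(w,1)=wa$ where $a\in A$ is the letter with $\mathrm{lps}(wa)=a\,\mathrm{lpps}(w)\,a$; $\mathrm{StdExt}(w,j)=\mathrm{StdExt}(\mathrm{StdExt}(w,j-1),1)$ for $j>1$. $\mathrm{StdExt}(w)=\{\mathrm{StdExt}(w,j): j\ge0\}$. $\mathrm{MaxStdExt}(u,v)$ is the longest word in $\mathrm{StdExt}(v)\cap\mathrm{Prf}(u)$. Flexed palindromes: for $w\in R$, $T(w)=\{\mathrm{lps}(ub) : ub\in\mathrm{Prf}(w),\ b\in A,\ |u|\ge 2,\ ub\ne\mathrm{StdExt}(u,1)\}$. $\Gamma$ is the set of pairs $(w,r)$ with $w,r\in R$, $|r|>2$, $r\in T(w)$, $r\notin F(\mathrm{lpp}(w))$, and $|r|\ge|\bar r|$ for every $\bar r\in T(w)$. For $(w,r)\in\Gamma$, $\mathrm{parse}(w,r)=(v,z,t)$ is the unique triple of rich words with $vzt=w$, $r\in\mathrm{Suf}(v)$, $\mathrm{occur}(w,r)=\mathrm{occur}(v,r)$, and $vz=\mathrm{MaxStdExt}(vzt,v)$. (So $v$ is the shortest prefix of $w$ containing all occurrences of $r$.) Reduced prefix $\mathrm{rdcPrf}(w,r)$ for $(w,r)\in\Gamma$: let $(v,z,t)=\mathrm{parse}(w,r)$. There is a prefix $h$ of $w$ such that $w=hz^R\,\mathrm{lps}(v)\,zt$, and $r$ is both a prefix and a suffix of $\mathrm{lps}(v)$, so $hz^Rr\in\mathrm{Prf}(w)$.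 Case 1: $r\in F(hz^R\,\mathrm{rtrim}(r))$. Let $g$ be the complete return to $r$ that is a suffix of $hz^Rr$, and let $\bar g$ be such that $\bar g g=hz^Rr$. Then $\mathrm{rdcPrf}(w,r)=\bar g r z$. Case 2: $r\notin F(hz^R\,\mathrm{rtrim}(r))$. Then $\mathrm{rdcPrf}(w,r)$ is the shortest word in the (nonempty) set $U=\{u : u\in\mathrm{Prf}(\mathrm{pc}(hz^R\,\mathrm{rtrim}(r))),\ \mathrm{ltrim}(r)z\in\mathrm{Suf}(u)\}$. Reduced word: $\mathrm{rdcWrd}(w,r)=\mathrm{rdcPrf}(w,r)\,t$, where $(v,z,t)=\mathrm{parse}(w,r)$. *)

theory Defs
  imports Main "HOL-Library.Sublist"
begin

text \<open>
  Words over a finite alphabet are lists over a type of class \<open>finite\<close>; the type is the alphabet.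
  Factors, prefixes and suffixes are \<^const>\<open>sublist\<close> (contiguous), \<^const>\<open>prefix\<close> and
  \<^const>\<open>suffix\<close>. Words called longest or shortest below are taken among the prefixes, or among
  the suffixes, of one fixed word, so they are determined by their length.
\<close>

definition palindrome :: "'a list \<Rightarrow> bool" where
  "palindrome w \<longleftrightarrow> rev w = w"

definition rich :: "'a list \<Rightarrow> bool" where
  "rich w \<longleftrightarrow> card {p. sublist p w \<and> palindrome p} = length w + 1"

definition lps :: "'a list \<Rightarrow> 'a list" where
  "lps w = (ARG_MAX length p. suffix p w \<and> palindrome p)"

definition lpp :: "'a list \<Rightarrow> 'a list" where
  "lpp w = (ARG_MAX length p. prefix p w \<and> palindrome p)"

text \<open>Used for words of length at least 2 only.\<close>

definition lpps :: "'a list \<Rightarrow> 'a list" where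
  "lpps w = (ARG_MAX length p. strict_suffix p w \<and> palindrome p)"

text \<open>An occurrence of \<open>v\<close> in \<open>u\<close> is identified with the part of \<open>u\<close> to its left. Used for nonempty
  \<open>v\<close> only.\<close>

definition occur :: "'a list \<Rightarrow> 'a list \<Rightarrow> nat" where
  "occur u v = card {x. \<exists>y. u = x @ v @ y}"

definition lcs :: "'a list \<Rightarrow> 'a list \<Rightarrow> 'a list" where
  "lcs u v = (ARG_MAX length s. suffix s u \<and> suffix s v)"

text \<open>Palindromic closure.\<close>

definition pc :: "'a list \<Rightarrow> 'a list" where
  "pc w = (let v = lps w; u = (THE u. w = u @ v) in u @ v @ rev u)"

definition complete_return :: "'a list \<Rightarrow> 'a list \<Rightarrow> bool" where
  "complete_return g r \<longleftrightarrow> occur g r = 2 \<and> prefix r g \<and> suffix r g"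

text \<open>
  One step of the standard extension. For \<open>length w \<ge> 2\<close> the letter exists and is unique: it is the
  letter preceding the suffix \<open>lpps w\<close> of \<open>w\<close>.
\<close>

definition std_step :: "'a list \<Rightarrow> 'a list" where
  "std_step w = w @ [THE a. lps (w @ [a]) = [a] @ lpps w @ [a]]"

primrec StdExt :: "'a list \<Rightarrow> nat \<Rightarrow> 'a list" where
  "StdExt w 0 = w"
| "StdExt w (Suc j) = std_step (StdExt w j)"

definition StdExts :: "'a list \<Rightarrow> 'a list set" where
  "StdExts w = {StdExt w j | j. j \<ge> 0}"

definition MaxStdExt :: "'a list \<Rightarrow> 'a list \<Rightarrow> 'a list" where
  "MaxStdExt u v = (ARG_MAX length x. x \<in> StdExts v \<and> prefix x u)"

text \<open>The set \<open>T(w)\<close> of flexed palindromes of a rich word \<open>w\<close>.\<close>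

definition flexed :: "'a list \<Rightarrow> 'a list set" where
  "flexed w = {lps (u @ [b]) | u b.
     prefix (u @ [b]) w \<and> length u \<ge> 2 \<and> u @ [b] \<noteq> StdExt u 1}"

definition \<Gamma> :: "('a list \<times> 'a list) set" where
  "\<Gamma> = {(w, r). rich w \<and> rich r \<and> length r > 2 \<and> r \<in> flexed w \<and> \<not> sublist r (lpp w) \<and>
     (\<forall>r' \<in> flexed w. length r \<ge> length r')}"

definition parse :: "'a list \<Rightarrow> 'a list \<Rightarrow> 'a list \<times> 'a list \<times> 'a list" where
  "parse w r = (THE (v, z, t). rich v \<and> rich z \<and> rich t \<and> v @ z @ t = w \<and> suffix r v \<and>
     occur w r = occur v r \<and> v @ z = MaxStdExt (v @ z @ t) v)"

text \<open>\<^const>\<open>butlast\<close> and \<^const>\<open>tl\<close> are the operations rtrim and ltrim.\<close>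

definition rdcPrf :: "'a list \<Rightarrow> 'a list \<Rightarrow> 'a list" where
  "rdcPrf w r =
    (let (v, z, t) = parse w r;
         h = (THE h. w = h @ rev z @ lps v @ z @ t)
     in if sublist r (h @ rev z @ butlast r)
        then let g = (THE g. complete_return g r \<and> suffix g (h @ rev z @ r));
                 g' = (THE g'. g' @ g = h @ rev z @ r)
             in g' @ r @ z
        else (ARG_MIN length u. prefix u (pc (h @ rev z @ butlast r)) \<and> suffix (tl r @ z) u))"

definition rdcWrd :: "'a list \<Rightarrow> 'a list \<Rightarrow> 'a list" where
  "rdcWrd w r = (let (v, z, t) = parse w r in rdcPrf w r @ t)"

end

theory Submission
  imports Defs
begin

text \<open>
  Write \<open>w = v z t\<close> and \<open>f = ltrim(r) z\<close>. The reduced word is \<open>P t\<close>, where \<open>P\<close> is a rich word that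
  also ends with \<open>f\<close>. Since \<open>v z\<close> is a maximal standard extension and no flexed palindrome is longer
  than \<open>r\<close>, the longest palindromic suffix of \<open>v z t\<^sub>1\<close>, for a nonempty prefix \<open>t\<^sub>1\<close> of \<open>t\<close>, never
  reaches back beyond \<open>f t\<^sub>1\<close>; hence it is also a palindromic suffix of \<open>P t\<^sub>1\<close>. Everything
  follows once it is shown to occur only once in \<open>P t\<^sub>1\<close>: then \<open>P t\<close> is rich and reading \<open>t\<close>
  creates the same palindromes after \<open>P\<close> as after \<open>v z\<close>. An earlier occurrence would either lie
  in \<open>P\<close> or contain \<open>f\<close> together with the letters around it in \<open>P t\<^sub>1\<close>; looking at the first place
  in \<open>w\<close> where the resulting factor (or its reversal) appears, the longest palindromic suffix
  there is longer than \<open>r\<close>, hence not flexed, and this forces a still earlier appearance.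
\<close>

subsection \<open>Palindromic prefixes and suffixes\<close>

lemma palindrome_Nil [simp]: "palindrome []"
  by (simp add: palindrome_def)

lemma palindrome_enclose: "palindrome (u @ p @ rev u) \<longleftrightarrow> palindrome p"
  by (simp add: palindrome_def)

lemma suffix_palindrome_iff_prefix:
  assumes "palindrome p"
  shows "suffix q p \<longleftrightarrow> prefix (rev q) p"
  using assms by (simp add: suffix_to_prefix palindrome_def)

lemma sublist_prefix_trans: "sublist q p \<Longrightarrow> prefix p u \<Longrightarrow> sublist q u"
  using prefix_imp_sublist sublist_order.order_trans by blast

lemma sublist_suffix_trans: "sublist q p \<Longrightarrow> suffix p u \<Longrightarrow> sublist q u"
  using suffix_imp_sublist sublist_order.order_trans by blast

lemma suffix_sublist_trans: "suffix q p \<Longrightarrow> sublist p u \<Longrightarrow> sublist q u"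
  using suffix_imp_sublist sublist_order.order_trans by blast

lemma
  shows suffix_lps: "suffix (lps w) w"
    and palindrome_lps: "palindrome (lps w)"
    and length_le_lps: "suffix p w \<Longrightarrow> palindrome p \<Longrightarrow> length p \<le> length (lps w)"
proof -
  have "(suffix (lps w) w \<and> palindrome (lps w)) \<and>
    (\<forall>y. suffix y w \<and> palindrome y \<longrightarrow> length y \<le> length (lps w))"
    unfolding lps_def
    by (rule arg_max_nat_lemma[where k = "[]" and b = "Suc (length w)"])
      (auto dest: suffix_length_le)
  then show "suffix (lps w) w" "palindrome (lps w)"
    "suffix p w \<Longrightarrow> palindrome p \<Longrightarrow> length p \<le> length (lps w)"
    by auto
qed

lemma
  assumes "w \<noteq> []"
  shows strict_suffix_lpps: "strict_suffix (lpps w) w"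
    and palindrome_lpps: "palindrome (lpps w)"
    and length_le_lpps: "strict_suffix p w \<Longrightarrow> palindrome p \<Longrightarrow> length p \<le> length (lpps w)"
proof -
  have "(strict_suffix (lpps w) w \<and> palindrome (lpps w)) \<and>
    (\<forall>y. strict_suffix y w \<and> palindrome y \<longrightarrow> length y \<le> length (lpps w))"
    unfolding lpps_def
    by (rule arg_max_nat_lemma[where k = "[]" and b = "Suc (length w)"])
      (use assms in \<open>auto simp: strict_suffix_def dest: suffix_length_le\<close>)
  then show "strict_suffix (lpps w) w" "palindrome (lpps w)"
    "strict_suffix p w \<Longrightarrow> palindrome p \<Longrightarrow> length p \<le> length (lpps w)"
    by auto
qed

lemma
  shows prefix_lpp: "prefix (lpp w) w"
    and length_le_lpp: "prefix p w \<Longrightarrow> palindrome p \<Longrightarrow> length p \<le> length (lpp w)"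
proof -
  have "(prefix (lpp w) w \<and> palindrome (lpp w)) \<and>
    (\<forall>y. prefix y w \<and> palindrome y \<longrightarrow> length y \<le> length (lpp w))"
    unfolding lpp_def
    by (rule arg_max_nat_lemma[where k = "[]" and b = "Suc (length w)"])
      (auto dest: prefix_length_le)
  then show "prefix (lpp w) w"
    "prefix p w \<Longrightarrow> palindrome p \<Longrightarrow> length p \<le> length (lpp w)"
    by auto
qed

lemma suffix_eq_length: "suffix p w \<Longrightarrow> suffix q w \<Longrightarrow> length p = length q \<Longrightarrow> p = q"
  by (auto simp: suffix_def)

lemma prefix_eq_length: "prefix p w \<Longrightarrow> prefix q w \<Longrightarrow> length p = length q \<Longrightarrow> p = q"
  by (auto simp: prefix_def)

lemma lps_eqI:
  assumes "suffix p w" "palindrome p" "length (lps w) \<le> length p"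
  shows "lps w = p"
  using assms length_le_lps suffix_lps suffix_eq_length le_antisym by metis

text \<open>A word that is not a palindrome has only proper palindromic suffixes, so the two maxima
  range over the same words.\<close>

lemma lpps_eq_lps:
  assumes "w \<noteq> []" "lps w \<noteq> w"
  shows "lpps w = lps w"
proof -
  have "strict_suffix (lps w) w"
    using assms suffix_lps by (simp add: strict_suffix_def)
  moreover have "length (lpps w) \<le> length (lps w)"
    using assms by (intro length_le_lps palindrome_lpps)
      (metis strict_suffix_lpps strict_suffix_def)
  moreover have "length (lps w) \<le> length (lpps w)"
    using assms calculation by (intro length_le_lpps palindrome_lps)
  ultimately show ?thesis
    using assms strict_suffix_lpps suffix_lps suffix_eq_length
    by (metis le_antisym strict_suffix_def)
qed

subsection \<open>Standard extension\<close>

text \<open>Stripping the outer letters relates palindromic suffixes of \<open>k @ [b]\<close> to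
  those palindromic suffixes of \<open>k\<close> that are preceded by \<open>b\<close>.\<close>

lemma snoc_palindromeE:
  assumes "palindrome q" "suffix q (k @ [b])" "2 \<le> length q"
  obtains s where "q = b # s @ [b]" "palindrome s" "suffix (b # s) k"
proof -
  from assms(2,3) obtain q' where q': "q = q' @ [b]" "suffix q' k" by auto
  with assms(3) obtain c s where "q' = c # s" by (cases q') auto
  with q' have q: "q = c # s @ [b]" "suffix (c # s) k" by simp_all
  from assms(1) have "b # (rev s @ [c]) = c # (s @ [b])"
    by (simp only: palindrome_def q(1) rev.simps rev_append append.simps append_assoc)
  then have "c = b" "palindrome s"
    unfolding palindrome_def by (metis list.inject append1_eq_conv)+
  with q show thesis by (simp add: that)
qed

text \<open>A longer palindromic suffix of \<open>k @ [d]\<close>, stripped of its outer letters,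
  would be a proper palindromic suffix of \<open>k\<close> longer than
  \<open>lpps k\<close>.\<close>

lemma lps_snoc_lpps:
  assumes "k = u @ d # lpps k"
  shows "lps (k @ [d]) = d # lpps k @ [d]"
proof (rule lps_eqI)
  have ne: "k \<noteq> []" using assms by auto
  show "suffix (d # lpps k @ [d]) (k @ [d])"
    using assms by (metis append_Cons append_assoc suffixI)
  show "palindrome (d # lpps k @ [d])"
    using palindrome_lpps[OF ne] by (simp add: palindrome_def)
  show "length (lps (k @ [d])) \<le> length (d # lpps k @ [d])"
  proof (cases "2 \<le> length (lps (k @ [d]))")
    case True
    obtain s where s: "lps (k @ [d]) = d # s @ [d]" "palindrome s" "suffix (d # s) k"
      using snoc_palindromeE[OF palindrome_lps suffix_lps True] by metis
    then have "length s \<le> length (lpps k)"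
      using length_le_lpps[OF ne] suffix_ConsD' by metis
    with s show ?thesis by simp
  qed auto
qed

lemma lpps_decomp:
  assumes "k \<noteq> []"
  obtains u d where "k = u @ d # lpps k"
proof -
  from strict_suffix_lpps[OF assms] obtain u where u: "k = u @ lpps k" "u \<noteq> []"
    unfolding strict_suffix_def suffix_def by (metis append_Nil)
  then show ?thesis
    using that[of "butlast u" "last u"]
    by (metis append_Cons append_Nil append_assoc append_butlast_last_id)
qed

lemma std_step_eq:
  assumes "k = u @ d # lpps k"
  shows "std_step k = k @ [d]"
proof -
  have "(THE a. lps (k @ [a]) = [a] @ lpps k @ [a]) = d"
  proof (rule the_equality)
    fix a assume "lps (k @ [a]) = [a] @ lpps k @ [a]"
    then have "suffix ((a # lpps k) @ [a]) (k @ [a])"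
      using suffix_lps[of "k @ [a]"] by simp
    then have "suffix (a # lpps k) k" by (simp only: snoc_suffix_snoc)
    moreover have "suffix (d # lpps k) k" using assms by (metis suffixI)
    ultimately show "a = d" using suffix_eq_length by fastforce
  qed (use lps_snoc_lpps[OF assms] in simp)
  then show ?thesis by (simp add: std_step_def)
qed

lemma lps_std_step:
  assumes "k \<noteq> []" "k @ [b] = std_step k"
  shows "lps (k @ [b]) = b # lpps k @ [b]"
proof -
  obtain u d where d: "k = u @ d # lpps k" using assms lpps_decomp by metis
  with assms(2) std_step_eq[OF d] have "b = d" by simp
  with lps_snoc_lpps[OF d] show ?thesis by simp
qed

text \<open>Since \<open>b # lps k\<close> is a suffix of \<open>k\<close>, the palindrome
  \<open>lps k\<close> is proper and agrees with \<open>lpps k\<close>; thus standard steps can be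
  recognised from \<open>lps\<close> alone.\<close>

lemma std_stepI:
  assumes "lps (k @ [b]) = b # lps k @ [b]"
  shows "k @ [b] = std_step k"
proof -
  have "suffix ((b # lps k) @ [b]) (k @ [b])"
    using suffix_lps[of "k @ [b]"] assms by simp
  then have "suffix (b # lps k) k" by (simp only: snoc_suffix_snoc)
  then obtain u where u: "k = u @ b # lps k" by (auto simp: suffix_def)
  then have "lps k \<noteq> k" "k \<noteq> []" by auto
  then have "lpps k = lps k" by (simp add: lpps_eq_lps)
  with u std_step_eq show ?thesis by metis
qed

lemma std_step_decomp:
  assumes "k \<noteq> []"
  shows "\<exists>b. std_step k = k @ [b]"
  by (simp add: std_step_def)

subsection \<open>Richness\<close>

definition pals :: "'a list \<Rightarrow> 'a list set" where
  "pals w = {p. sublist p w \<and> palindrome p}"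

lemma finite_pals [simp]: "finite (pals w)"
  by (rule finite_subset[of _ "set (sublists w)"]) (auto simp: pals_def)

lemma sublist_snoc_iff: "sublist q (k @ [b]) \<longleftrightarrow> sublist q k \<or> suffix q (k @ [b])"
proof -
  have "sublist (rev q) (b # rev k) \<longleftrightarrow> prefix (rev q) (b # rev k) \<or> sublist (rev q) (rev k)"
    by (rule sublist_Cons_right)
  then show ?thesis
    using sublist_rev[of q "k @ [b]"] sublist_rev[of q k] suffix_to_prefix[of q "k @ [b]"] by auto
qed

text \<open>Reversal inside the palindrome \<open>p\<close> turns its suffix \<open>q\<close> into a
  prefix, which ends before the last letter.\<close>

lemma palindrome_suffix_shorter:
  assumes "suffix p (k @ [b])" "palindrome p" "suffix q (k @ [b])" "palindrome q"
    "length q < length p"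
  shows "sublist q k"
proof -
  obtain u where u: "p = u @ q"
    using suffix_length_suffix[OF assms(3,1)] assms(5) by (auto simp: suffix_def)
  then have p: "p = q @ rev u" using assms by (metis palindrome_def rev_append)
  from u assms(5) have "u \<noteq> []" by auto
  then obtain c u' where "rev u = u' @ [c]" by (cases "rev u" rule: rev_cases) auto
  with p assms(1) have "suffix ((q @ u') @ [c]) (k @ [b])" by simp
  then have "suffix (q @ u') k" by (simp only: snoc_suffix_snoc)
  then show ?thesis by (auto simp: suffix_def)
qed

text \<open>Palindromic suffixes shorter than the longest one have occurred before, so each letter
  adds at most one palindrome. This is the source of the bound \<open>length w + 1\<close>.\<close>

lemma pals_snoc: "pals (k @ [b]) = insert (lps (k @ [b])) (pals k)"
proof -
  have "q = lps (k @ [b]) \<or> sublist q k" if "suffix q (k @ [b])" "palindrome q" for q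
  proof (cases "length q < length (lps (k @ [b]))")
    case True
    then show ?thesis
      using palindrome_suffix_shorter[OF suffix_lps palindrome_lps that] by simp
  next
    case False
    then show ?thesis using lps_eqI[OF that] by simp
  qed
  then show ?thesis
    using suffix_lps palindrome_lps unfolding pals_def sublist_snoc_iff by blast
qed

lemma pals_Nil [simp]: "pals [] = {[]}"
  by (auto simp: pals_def)

lemma card_pals_le: "card (pals w) \<le> length w + 1"
proof (induction w rule: rev_induct)
  case (snoc b k)
  then show ?case
    by (simp add: pals_snoc card_insert_if)
qed simp

lemma rich_Nil [simp]: "rich []"
unfolding rich_def pals_def[symmetric] by simp

text \<open>Richness means that the bound is attained, so every single letter has to contribute a
  new palindrome, and only the longest palindromic suffix can be new.\<close>

lemma rich_snoc: "rich (k @ [b]) \<longleftrightarrow> rich k \<and> \<not> sublist (lps (k @ [b])) k"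
proof -
  have "rich (k @ [b]) \<longleftrightarrow> card (insert (lps (k @ [b])) (pals k)) = length k + 2"
    by (simp add: rich_def pals_snoc[symmetric] pals_def[symmetric])
  also have "\<dots> \<longleftrightarrow> rich k \<and> lps (k @ [b]) \<notin> pals k"
    using card_pals_le[of k] by (auto simp: rich_def pals_def[symmetric] card_insert_if)
  finally show ?thesis by (simp add: pals_def palindrome_lps)
qed

lemma rich_rev: "rich (rev w) \<longleftrightarrow> rich w"
proof -
  have "{p. sublist p (rev w) \<and> palindrome p} = {p. sublist p w \<and> palindrome p}"
    by (metis palindrome_def sublist_rev)
  then show ?thesis by (simp add: rich_def)
qed

lemma rich_appendD1: "rich (u @ v) \<Longrightarrow> rich u"
proof (induction v rule: rev_induct)
  case (snoc b v)
  then show ?case by (metis append_assoc rich_snoc)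
qed simp

lemma rich_appendD2: "rich (u @ v) \<Longrightarrow> rich v"
  using rich_appendD1[of "rev v" "rev u"] by (metis rich_rev rev_append)

lemma rich_prefix: "rich w \<Longrightarrow> prefix k w \<Longrightarrow> rich k"
  by (auto simp: prefix_def intro: rich_appendD1)

lemma rich_sublist: "rich w \<Longrightarrow> sublist k w \<Longrightarrow> rich k"
  by (metis rich_appendD1 rich_appendD2 sublist_def)

text \<open>Any palindromic suffix shorter than the longest one would already occur in
  \<open>k\<close>.\<close>

lemma lps_eqI_fresh:
  assumes "suffix q (k @ [b])" "palindrome q" "\<not> sublist q k"
  shows "lps (k @ [b]) = q"
proof (rule lps_eqI)
  show "length (lps (k @ [b])) \<le> length q"
    using palindrome_suffix_shorter[OF suffix_lps palindrome_lps assms(1,2)] assms(3)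
    by (metis linorder_not_less)
qed (use assms in auto)

lemma rich_snocI:
  assumes "rich k" "suffix q (k @ [b])" "palindrome q" "\<not> sublist q k"
  shows "rich (k @ [b])"
  using assms lps_eqI_fresh[OF assms(2-4)] by (simp add: rich_snoc)

text \<open>If the suffix \<open>f\<close> or its reversal occurs earlier, then so does every palindromic suffix of \<open>f\<close>,
  whereas the longest palindromic suffix of a rich word occurs only once.\<close>

lemma length_lps_gt:
  assumes "rich (k @ [b])" "suffix f (k @ [b])" "sublist f k \<or> sublist (rev f) k"
  shows "length f < length (lps (k @ [b]))"
proof (rule ccontr)
  assume "\<not> ?thesis"
  then have "suffix (lps (k @ [b])) f"
    using suffix_length_suffix[OF suffix_lps assms(2)] by simp
  then have "sublist (lps (k @ [b])) f"
    by simp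
  moreover from this have "sublist (lps (k @ [b])) (rev f)"
    using palindrome_lps[of "k @ [b]"] by (simp add: sublist_rev_left[symmetric] palindrome_def)
  moreover note assms(3)
  ultimately have "sublist (lps (k @ [b])) k"
    using sublist_order.order_trans by blast
  with assms(1) show False by (simp add: rich_snoc)
qed

text \<open>Locates the end of the first occurrence of \<open>q\<close>, the starting point of the
  arguments by earliest appearance below.\<close>

lemma shortest_prefix_containing:
  assumes "sublist q w" "q \<noteq> []"
  obtains k b where "prefix (k @ [b]) w" "suffix q (k @ [b])" "\<not> sublist q k"
  using assms
proof (induction w arbitrary: thesis rule: rev_induct)
  case (snoc c w)
  show ?case
  proof (cases "sublist q w")
    case True
    then show ?thesis using snoc by (metis prefix_order.order_trans prefixI)
  next
    case False
    then show ?thesis using snoc.prems(1)[of w c] snoc.prems(2) by (simp add: sublist_snoc_iff)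
  qed
qed simp

text \<open>A factor that fits neither into \<open>u @ f\<close> nor into \<open>f @ t\<close>
  starts in \<open>u\<close> and ends in \<open>t\<close>, so it covers \<open>f\<close> together
  with both neighbouring letters.\<close>

lemma sublist_straddle:
  assumes "sublist q (u @ f @ t)" "\<not> sublist q (u @ f)" "\<not> sublist q (f @ t)"
  obtains "u \<noteq> []" "t \<noteq> []" "sublist (last u # f @ [hd t]) q"
proof -
  from assms(1,3) obtain q1 q2 where q: "q = q1 @ q2" "suffix q1 u" "prefix q2 (f @ t)"
    using assms(2) by (auto simp: sublist_append[of q u] )
  have 1: "q1 \<noteq> []" using q assms(3) by auto
  from q(3) have "prefix q2 f \<or> (\<exists>q3. q2 = f @ q3 \<and> prefix q3 t)"
    by (auto simp: prefix_append)
  then show ?thesis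
  proof
    assume "prefix q2 f"
    then have "sublist q (u @ f)" using q by (auto simp: sublist_append)
    with assms(2) show ?thesis ..
  next
    assume "\<exists>q3. q2 = f @ q3 \<and> prefix q3 t"
    then obtain q3 where q3: "q2 = f @ q3" "prefix q3 t" by auto
    have 3: "q3 \<noteq> []" using q3 q assms(2) by (auto simp: suffix_def)
    obtain q1' where q1': "q1 = q1' @ [last u]"
      using 1 q(2) by (cases q1 rule: rev_cases) (auto simp: suffix_def)
    obtain q3' where q3': "q3 = hd t # q3'"
      using 3 q3(2) by (cases q3) (auto simp: prefix_def)
    have "q = q1' @ (last u # f @ [hd t]) @ q3'" using q q3 q1' q3' by simp
    then have "sublist (last u # f @ [hd t]) q" by (metis sublist_appendI)
    moreover have "u \<noteq> []" "t \<noteq> []" using 1 3 q(2) q3(2) by auto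
    ultimately show ?thesis using that by blast
  qed
qed

section \<open>Common prefixes and suffixes, palindromic closure\<close>

lemma length_le_longest_common_prefix:
  "prefix p u \<Longrightarrow> prefix p v \<Longrightarrow> length p \<le> length (longest_common_prefix u v)"
  by (intro prefix_length_le longest_common_prefix_max_prefix)

lemma length_le_lcs:
  assumes "suffix s u" "suffix s v"
  shows "length s \<le> length (lcs u v)"
  unfolding lcs_def using assms
  by (intro arg_max_nat_le[where b = "Suc (length u)"]) (auto dest: suffix_length_le)

lemma pc_eq:
  assumes "w = u @ lps w"
  shows "pc w = w @ rev u"
proof -
  have "(THE u. w = u @ lps w) = u"
    using assms by (intro the_equality) (metis append_same_eq)+
  then have "pc w = u @ lps w @ rev u" by (simp only: pc_def Let_def)
  with assms show ?thesis by (metis append_assoc)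
qed

text \<open>Followed by a letter, \<open>lps k\<close> would occur a second time, before the end of
  \<open>k\<close>, although the longest palindromic suffix of a rich word occurs only once.\<close>

lemma rich_lps_snoc_not_sublist:
  assumes "rich k"
  shows "\<not> sublist (lps k @ [d]) k"
proof
  assume "sublist (lps k @ [d]) k"
  then obtain a b where ab: "k = a @ lps k @ [d] @ b" by (auto simp: sublist_def)
  \<comment> \<open>Dropping the last letter of \<open>k\<close> only shortens \<open>d # b\<close>,
    so this occurrence of \<open>lps k\<close> survives.\<close>
  then have "k = (a @ lps k @ butlast (d # b)) @ [last (d # b)]"
    by (metis append_Cons append_Nil append_assoc append_butlast_last_id list.distinct(1))
  moreover have "sublist (lps k) (a @ lps k @ butlast (d # b))" by simp
  ultimately show False using assms rich_snoc by metis
qed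

subsection \<open>Iterated standard extension\<close>

text \<open>Appending \<open>c\<close> mirrors the letters in front of \<open>lps y\<close>. Each
  new palindrome contains the previous longest palindromic suffix followed by a letter, so by
  \<open>rich_lps_snoc_not_sublist\<close> it has not occurred before.\<close>

lemma rich_std_extension:
  assumes "rich y" "y = u @ rev c @ lps y"
  shows "rich (y @ c) \<and> lps (y @ c) = rev c @ lps y @ c"
  using assms(2)
proof (induction c arbitrary: u rule: rev_induct)
  case (snoc d c)
  let ?q = "rev c @ lps y @ c"
  from snoc.prems have y: "y = (u @ [d]) @ rev c @ lps y" by simp
  from snoc.IH[OF this] have IH: "rich (y @ c)" "lps (y @ c) = ?q" by auto
  have fresh: "\<not> sublist (d # ?q @ [d]) (y @ c)"
  proof
    assume "sublist (d # ?q @ [d]) (y @ c)"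
    then have "sublist (?q @ [d]) (y @ c)"
      by (metis append_Cons append_Nil sublist_append_leftI sublist_order.order_trans)
    with rich_lps_snoc_not_sublist[OF IH(1)] IH(2) show False by metis
  qed
  have pal: "palindrome (d # ?q @ [d])"
    using palindrome_lps[of y] by (simp add: palindrome_def)
  have suf: "suffix (d # ?q @ [d]) ((y @ c) @ [d])"
    using arg_cong[OF y, of "\<lambda>y. y @ c @ [d]"] by (auto intro: suffixI[where zs = u])
  show ?case
    using rich_snocI[OF IH(1) suf pal fresh] lps_eqI_fresh[OF suf pal fresh] by simp
qed (use assms in simp)

text \<open>A new palindrome first appears as the longest palindromic suffix of some
  \<open>y @ c1\<close>. That suffix is \<open>rev c1 @ lps y @ c1\<close>, which has
  \<open>e # lps y @ [e]\<close> at its centre.\<close>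

lemma new_palindrome_std_extension:
  assumes "rich y" "y = u @ rev (e # c) @ lps y"
    and "prefix c' (e # c)" "palindrome q" "sublist q (y @ c')" "\<not> sublist q y"
  shows "sublist (e # lps y @ [e]) q"
proof -
  from assms(6) have "q \<noteq> []" by auto
  with assms(5) obtain k b where kb: "prefix (k @ [b]) (y @ c')" "suffix q (k @ [b])"
    "\<not> sublist q k"
    by (rule shortest_prefix_containing)
  have "\<not> prefix (k @ [b]) y"
    using kb(2) assms(6) by (meson prefix_imp_sublist sublist_order.order_trans suffix_imp_sublist)
  with kb(1) obtain c1 where c1: "k @ [b] = y @ c1" "prefix c1 c'"
    by (auto simp only: prefix_append)
  with \<open>\<not> prefix (k @ [b]) y\<close> have "c1 \<noteq> []" by auto
  moreover from c1 assms(3) have "prefix c1 (e # c)" using prefix_order.order_trans by blast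
  ultimately obtain c2 c3 where c2: "c1 = e # c2" "c = c2 @ c3"
    by (cases c1) (auto simp: prefix_def)
  have "y = (u @ rev c3) @ rev c1 @ lps y"
    using assms(2) c2 by simp
  then have "lps (y @ c1) = rev c1 @ lps y @ c1"
    using rich_std_extension assms(1) by blast
  moreover have "lps (y @ c1) = q"
    using lps_eqI_fresh[OF kb(2) assms(4) kb(3)] c1 by simp
  ultimately have "q = rev c2 @ (e # lps y @ [e]) @ c2" using c2 by simp
  then show ?thesis by (metis sublist_appendI)
qed

lemma prefix_StdExt:
  assumes "v \<noteq> []"
  shows "prefix v (StdExt v j)"
proof (induction j)
  case (Suc j)
  then have "StdExt v j \<noteq> []" using assms by auto
  with std_step_decomp Suc show ?case by (metis StdExt.simps(2) prefix_prefix)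
qed simp

lemma StdExts_self: "v \<in> StdExts v"
  unfolding StdExts_def using StdExt.simps(1) by (metis (mono_tags, lifting) mem_Collect_eq le0)

lemma StdExts_step: "k \<in> StdExts v \<Longrightarrow> std_step k \<in> StdExts v"
  unfolding StdExts_def by (auto intro: exI[of _ "Suc _"])

lemma
  assumes "prefix v w"
  shows MaxStdExt_in_StdExts: "MaxStdExt w v \<in> StdExts v"
    and prefix_MaxStdExt: "prefix (MaxStdExt w v) w"
    and length_le_MaxStdExt:
      "x \<in> StdExts v \<Longrightarrow> prefix x w \<Longrightarrow> length x \<le> length (MaxStdExt w v)"
proof -
  have "(MaxStdExt w v \<in> StdExts v \<and> prefix (MaxStdExt w v) w) \<and>
    (\<forall>x. x \<in> StdExts v \<and> prefix x w \<longrightarrow> length x \<le> length (MaxStdExt w v))"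
    unfolding MaxStdExt_def using assms
    by (intro arg_max_nat_lemma[where k = v and b = "Suc (length w)"])
      (auto simp: StdExts_self dest: prefix_length_le)
  then show "MaxStdExt w v \<in> StdExts v" "prefix (MaxStdExt w v) w"
    "x \<in> StdExts v \<Longrightarrow> prefix x w \<Longrightarrow> length x \<le> length (MaxStdExt w v)"
    by auto
qed

subsection \<open>Occurrences and complete returns\<close>

text \<open>The left contexts are kept as a set so that values of \<open>occur\<close> can be
  compared through inclusions.\<close>

definition occs :: "'a list \<Rightarrow> 'a list \<Rightarrow> 'a list set" where
  "occs u v = {x. \<exists>y. u = x @ v @ y}"

lemma occur_eq_card_occs: "occur u v = card (occs u v)"
  by (simp add: occur_def occs_def)

lemma finite_occs [simp]: "finite (occs u v)"
  by (rule finite_subset[of _ "set (prefixes u)"]) (auto simp: occs_def prefix_def)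

lemma mem_occs_iff: "x \<in> occs u v \<longleftrightarrow> prefix (x @ v) u"
  by (auto simp: occs_def prefix_def)

lemma occs_prefix_mono: "prefix u u' \<Longrightarrow> occs u v \<subseteq> occs u' v"
  unfolding subset_iff mem_occs_iff using prefix_order.order_trans by blast

lemma occs_eq_empty_iff: "occs u v = {} \<longleftrightarrow> \<not> sublist v u"
  by (auto simp: occs_def sublist_def)

text \<open>The two occurrences start at \<open>[]\<close> and at \<open>s\<close>; with
  \<open>s\<close> empty, \<open>g = r\<close> would contain only one.\<close>

lemma complete_return_iff:
  "complete_return g r \<longleftrightarrow> prefix r g \<and> (\<exists>s. s \<noteq> [] \<and> g = s @ r \<and> occs g r = {[], s})"
proof
  assume g: "complete_return g r"
  then obtain s where s: "g = s @ r" by (auto simp: complete_return_def suffix_def)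
  have "{[], s} \<subseteq> occs g r" using g s by (auto simp: complete_return_def mem_occs_iff)
  moreover have "card (occs g r) = 2"
    using g by (simp add: complete_return_def occur_eq_card_occs)
  moreover have "s \<noteq> []"
  proof
    assume "s = []"
    with s have "occs g r = {[]}" by (auto simp: mem_occs_iff) (auto dest: prefix_length_le)
    with \<open>card (occs g r) = 2\<close> show False by simp
  qed
  ultimately have "occs g r = {[], s}"
    by (metis card_2_iff card_subset_eq finite_occs)
  then show "prefix r g \<and> (\<exists>s. s \<noteq> [] \<and> g = s @ r \<and> occs g r = {[], s})"
    using g s \<open>s \<noteq> []\<close> by (auto simp: complete_return_def)
next
  assume "prefix r g \<and> (\<exists>s. s \<noteq> [] \<and> g = s @ r \<and> occs g r = {[], s})"
  then obtain s where s: "prefix r g" "s \<noteq> []" "g = s @ r" "occs g r = {[], s}" by blast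
  then have "card (occs g r) = 2" by (simp only: s(4)) simp
  then show "complete_return g r"
    unfolding complete_return_def occur_eq_card_occs using s(1,3) suffixI by blast
qed

text \<open>The return starts at the rightmost occurrence of \<open>r\<close> in
  \<open>x @ r\<close> other than the final one.\<close>

lemma ex_complete_return:
  assumes "sublist r (x @ butlast r)" "r \<noteq> []"
  obtains g where "complete_return g r" "suffix g (x @ r)"
proof -
  \<comment> \<open>A nonempty \<open>y\<close> singles out the occurrences other than the final
    one.\<close>
  let ?P = "\<lambda>x1. \<exists>y. y \<noteq> [] \<and> x @ r = x1 @ r @ y"
  from assms(1) obtain a b where "x @ butlast r = a @ r @ b" by (auto simp: sublist_def)
  then have "(x @ butlast r) @ [last r] = a @ r @ b @ [last r]" by simp
  then have "?P a" using assms(2) by (intro exI[of _ "b @ [last r]"]) simp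
  moreover have "\<forall>x1. ?P x1 \<longrightarrow> length x1 < Suc (length x)"
    by (auto dest: arg_cong[where f = length])
  ultimately obtain x1 where x1: "?P x1" "\<forall>x2. ?P x2 \<longrightarrow> length x2 \<le> length x1"
    using ex_has_greatest_nat[of ?P a length "Suc (length x)"] by blast
  then obtain y where y: "y \<noteq> []" "x @ r = x1 @ r @ y" by auto
  have len: "length x1 < length x"
  proof -
    have "length (x @ r) = length (x1 @ r @ y)" by (simp only: y(2))
    with y(1) show ?thesis by simp
  qed
  have "prefix x1 x"
    using prefix_length_prefix[of x1 "x @ r" x] len prefixI[OF y(2)] by simp
  then obtain s where s: "x = x1 @ s" by (auto simp: prefix_def)
  with y(2) len have s: "x = x1 @ s" "s \<noteq> []" "s @ r = r @ y" by simp_all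
  have "occs (r @ y) r = {[], s}"
  proof
    show "occs (r @ y) r \<subseteq> {[], s}"
    proof
      fix a assume "a \<in> occs (r @ y) r"
      then obtain b where b: "r @ y = a @ r @ b" by (auto simp: occs_def)
      show "a \<in> {[], s}"
      proof (cases "b = []")
        case True
        with b s show ?thesis by simp
      next
        case False
        with b y have "?P (x1 @ a)" by auto
        with x1(2) have "length (x1 @ a) \<le> length x1" by blast
        then show ?thesis by simp
      qed
    qed
    show "{[], s} \<subseteq> occs (r @ y) r"
      using s(3) by (auto simp: mem_occs_iff)
  qed
  then have "complete_return (r @ y) r"
    unfolding complete_return_iff using s(2,3) by (metis prefixI)
  moreover have "suffix (r @ y) (x @ r)" using y(2) by (rule suffixI)
  ultimately show ?thesis by (rule that)
qed

text \<open>If one were a proper suffix of the other, its leading \<open>r\<close> would be a third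
  occurrence in the longer one.\<close>

lemma complete_return_suffix_unique:
  assumes "complete_return g r" "suffix g x" "complete_return g' r" "suffix g' x"
  shows "g = g'"
proof -
  have less: False if "complete_return g1 r" "complete_return g2 r" "suffix g1 g2" "g1 \<noteq> g2"
    for g1 g2 :: "'a list"
  proof -
    from that(1) obtain s1 y1 where 1: "s1 \<noteq> []" "g1 = s1 @ r" "g1 = r @ y1"
      by (auto simp: complete_return_iff prefix_def)
    from that(2) obtain s2 where 2: "g2 = s2 @ r" "occs g2 r = {[], s2}"
      by (auto simp: complete_return_iff)
    from that(3,4) obtain u where u: "g2 = u @ g1" "u \<noteq> []" by (auto simp: suffix_def)
    then have "u \<in> occs g2 r" using 1(3) by (auto simp: occs_def)
    with u 2(2) have "u = s2" by simp
    with u 2(1) have "g1 = r" by simp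
    with 1(1,2) show False by simp
  qed
  from suffix_same_cases[OF assms(2,4)] less[of g g'] less[of g' g] assms(1,3)
  show ?thesis by metis
qed

text \<open>Because \<open>r\<close> has occurred before, \<open>lps g\<close> is longer than
  \<open>r\<close>; being a palindrome with suffix \<open>r\<close>, it also starts with
  \<open>r\<close>. It cannot start at the final occurrence, so it starts at the first one and
  equals \<open>g\<close>.\<close>

lemma complete_return_palindrome:
  assumes "rich g" "palindrome r" "complete_return g r"
  shows "palindrome g"
proof -
  from assms(3) obtain s where s: "s \<noteq> []" "g = s @ r" "occs g r = {[], s}" "prefix r g"
    by (auto simp: complete_return_iff)
  have "g \<noteq> []" using s(1,2) by simp
  then obtain s' b where g: "g = s' @ [b]" by (metis append_butlast_last_id)
  have "sublist r s'"
  proof -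
    from s(4) g consider "prefix r s'" | "r = g" by (auto simp: prefix_snoc)
    then show ?thesis using s(1,2) by cases auto
  qed
  then have "length r < length (lps g)"
    using length_lps_gt[of s' b r] assms(1) unfolding g[symmetric] s(2)
    by (simp add: suffixI)
  moreover have "suffix r g" using s(2) by (rule suffixI)
  ultimately have "suffix r (lps g)"
    using suffix_length_suffix[OF _ suffix_lps] less_imp_le by blast
  then have "prefix r (lps g)"
    using suffix_palindrome_iff_prefix[OF palindrome_lps] assms(2) by (metis palindrome_def)
  moreover obtain u where u: "g = u @ lps g" using suffix_lps[of g] by (auto simp: suffix_def)
  ultimately have "u \<in> occs g r"
    by (metis mem_occs_iff same_prefix_prefix)
  moreover have "u \<noteq> s"
    using u s(2) \<open>length r < length (lps g)\<close> by auto
  ultimately have "u = []" using s(3) by simp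
  with u palindrome_lps show ?thesis by (metis append_Nil)
qed

subsection \<open>Flexed palindromes\<close>

lemma flexedI:
  "prefix (u @ [b]) w \<Longrightarrow> 2 \<le> length u \<Longrightarrow> u @ [b] \<noteq> std_step u \<Longrightarrow> lps (u @ [b]) \<in> flexed w"
  unfolding flexed_def by force

lemma flexedE:
  assumes "q \<in> flexed w"
  obtains u b where "q = lps (u @ [b])" "prefix (u @ [b]) w" "2 \<le> length u" "u @ [b] \<noteq> std_step u"
  using assms unfolding flexed_def by auto

lemma flexed_prefix_mono: "prefix u w \<Longrightarrow> flexed u \<subseteq> flexed w"
  unfolding flexed_def using prefix_order.order_trans by blast

text \<open>Every letter of \<open>c\<close> is a standard step, so no flexed palindrome arises
  after \<open>y\<close>.\<close>

lemma flexed_std_extension: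
  assumes "rich y" "y = u @ rev c @ lps y"
  shows "flexed (y @ c) \<subseteq> flexed y"
proof
  fix q assume "q \<in> flexed (y @ c)"
  then obtain k b where kb: "q = lps (k @ [b])" "prefix (k @ [b]) (y @ c)" "2 \<le> length k"
    "k @ [b] \<noteq> std_step k" by (rule flexedE)
  have "prefix (k @ [b]) y"
  proof (rule ccontr)
    assume np: "\<not> prefix (k @ [b]) y"
    with kb(2) obtain c1 where c1: "k @ [b] = y @ c1" "prefix c1 c"
      unfolding prefix_append by blast
    with np have "c1 \<noteq> []" by auto
    then obtain c0 b' where c0: "c1 = c0 @ [b']" by (metis append_butlast_last_id)
    with c1(1) have "k @ [b] = (y @ c0) @ [b']" by simp
    then have k: "k = y @ c0" "b' = b" by simp_all
    from c1(2) obtain c2 where c2: "c = c1 @ c2" by (auto simp: prefix_def)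
    have "y = (u @ rev c2) @ rev c1 @ lps y" using assms(2) c2 by simp
    then have "lps (y @ c1) = rev c1 @ lps y @ c1" using rich_std_extension assms(1) by blast
    moreover have "y = (u @ rev c2 @ [b]) @ rev c0 @ lps y" using assms(2) c2 c0 k by simp
    then have "lps (y @ c0) = rev c0 @ lps y @ c0" using rich_std_extension assms(1) by blast
    ultimately have "lps (k @ [b]) = b # lps k @ [b]" using c0 k by simp
    from kb(4) std_stepI[OF this] show False ..
  qed
  from flexedI[OF this kb(3,4)] kb(1) show "q \<in> flexed y" by simp
qed

subsection \<open>The parse of a word\<close>

text \<open>Cutting after the rightmost occurrence of \<open>r\<close> gives \<open>v\<close>. Any
  other candidate has equally many occurrences, hence by finiteness the same ones, and so ends with
  the rightmost one too. Later arguments use this as a bound on where \<open>r\<close> can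
  end.\<close>

lemma parse_eq:
  assumes rich: "rich w" and r: "sublist r w"
  obtains v z t where "parse w r = (v, z, t)" "w = v @ z @ t" "suffix r v"
    "\<And>\<alpha> \<beta>. w = \<alpha> @ r @ \<beta> \<Longrightarrow> length (\<alpha> @ r) \<le> length v"
    "v @ z = MaxStdExt w v"
proof -
  have "occs w r \<noteq> {}" using r occs_eq_empty_iff by blast
  then obtain x where x: "x \<in> occs w r" "\<And>x'. x' \<in> occs w r \<Longrightarrow> length x' \<le> length x"
    using ex_has_greatest_nat[of "\<lambda>x. x \<in> occs w r" _ length "Suc (length w)"]
    by (force simp: mem_occs_iff dest: prefix_length_le)
  let ?v = "x @ r"
  have pv: "prefix ?v w" using x(1) by (simp add: mem_occs_iff)
  have occs_v: "occs ?v r = occs w r"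
  proof
    show "occs ?v r \<subseteq> occs w r" using pv by (rule occs_prefix_mono)
    show "occs w r \<subseteq> occs ?v r"
    proof
      fix x' assume x': "x' \<in> occs w r"
      then have "prefix (x' @ r) w" by (simp add: mem_occs_iff)
      then show "x' \<in> occs ?v r"
        using prefix_length_prefix[OF _ pv] x(2)[OF x'] by (simp add: mem_occs_iff)
    qed
  qed
  define m where "m = MaxStdExt w ?v"
  have pm: "prefix m w" unfolding m_def using pv by (rule prefix_MaxStdExt)
  have vm: "prefix ?v m"
  proof (cases "?v = []")
    case False
    have "m \<in> StdExts ?v" unfolding m_def using pv by (rule MaxStdExt_in_StdExts)
    then show ?thesis using prefix_StdExt[OF False] unfolding StdExts_def by auto
  qed simp
  from vm obtain z where z: "m = ?v @ z" by (auto simp: prefix_def)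
  from pm obtain t where "w = m @ t" by (auto simp: prefix_def)
  with z have w: "w = ?v @ z @ t" by simp
  have "parse w r = (?v, z, t)"
    unfolding parse_def
  proof (rule the_equality)
    have "rich ?v" "rich z" "rich t"
      using rich unfolding w using rich_appendD1 rich_appendD2 by blast+
    then show "case (?v, z, t) of (v, z, t) \<Rightarrow> rich v \<and> rich z \<and> rich t \<and> v @ z @ t = w \<and>
      suffix r v \<and> occur w r = occur v r \<and> v @ z = MaxStdExt (v @ z @ t) v"
      using w z occs_v m_def by (simp add: occur_eq_card_occs suffix_def)
  next
    fix vzt :: "'a list \<times> 'a list \<times> 'a list"
    obtain v' z' t' where vzt: "vzt = (v', z', t')" by (cases vzt)
    assume "case vzt of (v, z, t) \<Rightarrow> rich v \<and> rich z \<and> rich t \<and> v @ z @ t = w \<and>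
      suffix r v \<and> occur w r = occur v r \<and> v @ z = MaxStdExt (v @ z @ t) v"
    then have *: "v' @ z' @ t' = w" "suffix r v'" "card (occs w r) = card (occs v' r)"
      "v' @ z' = MaxStdExt w v'"
      unfolding vzt occur_eq_card_occs by auto
    have pv': "prefix v' w" using *(1) by (metis prefixI)
    have occs_v': "occs v' r = occs w r"
      using occs_prefix_mono[OF pv'] *(3) by (metis card_subset_eq finite_occs)
    obtain x' where x': "v' = x' @ r" using *(2) by (auto simp: suffix_def)
    then have "x' \<in> occs w r" using pv' by (simp add: mem_occs_iff)
    moreover have "prefix ?v v'" using x(1) occs_v' by (simp add: mem_occs_iff[symmetric])
    then have "length x \<le> length x'" using x' by (auto dest: prefix_length_le)
    ultimately have "length ?v = length v'" using x(2) x' by fastforce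
    then have "v' = ?v" using prefix_eq_length[OF pv' pv] by simp
    with *(1,4) z w m_def vzt show "vzt = (?v, z, t)" by auto
  qed
  moreover have "length (\<alpha> @ r) \<le> length ?v" if "w = \<alpha> @ r @ \<beta>" for \<alpha> \<beta>
    using x(2)[of \<alpha>] that by (auto simp: occs_def)
  ultimately show thesis using that[of ?v z t] w z m_def by (simp add: suffix_def)
qed

text \<open>Each standard step copies the letter in front of the current longest palindromic suffix,
  so \<open>z\<close> appears mirrored to the left of \<open>lps v\<close>. Such a letter exists
  because no prefix of \<open>w\<close> containing \<open>r\<close> is a palindrome.\<close>

lemma StdExt_decomp:
  assumes "v \<noteq> []" "sublist r v"
    and np: "\<And>k. prefix k w \<Longrightarrow> palindrome k \<Longrightarrow> \<not> sublist r k"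
    and "prefix (StdExt v j) w"
  shows "\<exists>z h. StdExt v j = v @ z \<and> v = h @ rev z @ lps v \<and> lps (v @ z) = rev z @ lps v @ z"
  using assms(4)
proof (induction j)
  case 0
  obtain h where "v = h @ lps v" using suffix_lps[of v] by (auto simp only: suffix_def)
  then show ?case by (intro exI[of _ "[]"] exI[of _ h]) simp
next
  case (Suc j)
  obtain b where b: "std_step (StdExt v j) = StdExt v j @ [b]"
    using std_step_decomp prefix_StdExt[OF assms(1)] assms(1) by (metis prefix_Nil)
  with Suc.prems have p: "prefix (StdExt v j) w" by (metis StdExt.simps(2) append_prefixD)
  from Suc.IH[OF this] obtain z h where zh: "StdExt v j = v @ z" "v = h @ rev z @ lps v"
    "lps (v @ z) = rev z @ lps v @ z" by blast
  have ne: "lps (v @ z) \<noteq> v @ z"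
  proof
    assume "lps (v @ z) = v @ z"
    then have "palindrome (v @ z)" using palindrome_lps by metis
    moreover have "sublist r (v @ z)" using assms(2) by (simp add: sublist_append)
    ultimately show False using np p zh(1) by metis
  qed
  then have lpps: "lpps (v @ z) = rev z @ lps v @ z"
    using lpps_eq_lps[of "v @ z"] assms(1) zh(3) by simp
  have vz: "v @ z = h @ rev z @ lps v @ z" using zh(2) by (metis append_assoc)
  have "h \<noteq> []" using ne vz zh(3) by (metis append_Nil)
  then obtain h' d where h: "h = h' @ [d]" by (metis append_butlast_last_id)
  have dec: "v @ z = h' @ d # lpps (v @ z)" unfolding lpps using vz h by simp
  have "StdExt v (Suc j) = v @ (z @ [d])" using std_step_eq[OF dec] zh(1) by simp
  moreover have "v = h' @ rev (z @ [d]) @ lps v" using zh(2) h by simp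
  moreover have "lps (v @ (z @ [d])) = rev (z @ [d]) @ lps v @ (z @ [d])"
    using lps_snoc_lpps[OF dec] lpps by simp
  ultimately show ?case by blast
qed

subsection \<open>Replacing the prefix\<close>

text \<open>Collects what membership in \<open>\<Gamma>\<close> and the parse provide. The
  hypothesis on palindromic prefixes is the working form of \<open>r\<close> not occurring in
  \<open>lpp w\<close>, and \<open>t_not_std\<close> expresses the maximality of
  \<open>v @ z\<close>.\<close>

locale reduction =
  fixes v z t r h :: "'a list"
  assumes rich_w: "rich (v @ z @ t)"
    and palindrome_r: "palindrome r"
    and length_r: "2 < length r"
    and suffix_r_v: "suffix r v"
    and v_eq: "v = h @ rev z @ lps v"
    and last_r: "v @ z @ t = \<alpha> @ r @ \<beta> \<Longrightarrow> length (\<alpha> @ r) \<le> length v"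
    and length_flexed_le: "q \<in> flexed (v @ z @ t) \<Longrightarrow> length q \<le> length r"
    and r_flexed: "r \<in> flexed (v @ z @ t)"
    and not_in_palindromic_prefix:
      "prefix k (v @ z @ t) \<Longrightarrow> palindrome k \<Longrightarrow> \<not> sublist r k"
    and t_not_std: "t \<noteq> [] \<Longrightarrow> (v @ z) @ [hd t] \<noteq> std_step (v @ z)"
begin

text \<open>The word \<open>f\<close> ends both \<open>v @ z\<close> and the reduced prefix;
  \<open>y\<close> is the word closed in the second case, and in \<open>w\<close> it is followed by
  \<open>a\<close>.\<close>

abbreviation "w \<equiv> v @ z @ t"
abbreviation "f \<equiv> tl r @ z"
abbreviation "a \<equiv> hd r"
abbreviation "y \<equiv> h @ rev z @ butlast r"

lemma hd_Cons_tl_r: "a # tl r = r"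
  using length_r by (cases r) auto

lemma butlast_snoc_r: "butlast r @ [a] = r"
proof -
  have "rev (tl r) @ [a] = r"
    using hd_Cons_tl_r palindrome_r by (metis palindrome_def rev.simps(2))
  then show ?thesis by (metis butlast_snoc)
qed

lemma rev_tl_r: "rev (tl r) = butlast r"
proof -
  have "rev (a # tl r) = r" using hd_Cons_tl_r palindrome_r by (simp only: palindrome_def)
  then have "rev (tl r) @ [a] = butlast r @ [a]" by (simp only: rev.simps butlast_snoc_r)
  then show ?thesis by simp
qed

lemma rev_butlast_r: "rev (butlast r) = tl r"
  using rev_tl_r by (metis rev_rev_ident)

lemma rev_f: "rev f = rev z @ butlast r"
  by (simp add: rev_tl_r)

lemma Cons_f: "a # f = r @ z"
  using hd_Cons_tl_r by (metis append_Cons)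

lemma y_snoc: "y @ [a] = h @ rev z @ r"
  by (simp add: butlast_snoc_r)

lemma length_f: "length r \<le> length f + 1"
  using length_r by simp

lemma obtain_v0:
  obtains v0 where "v = v0 @ r"
  using suffix_r_v by (auto simp: suffix_def)

lemma suffix_Cons_f: "suffix (a # f) (v @ z)"
proof -
  obtain v0 where "v = v0 @ r" by (rule obtain_v0)
  then show ?thesis unfolding Cons_f by (simp add: suffix_def)
qed

text \<open>An occurrence inside \<open>f @ t\<close> would end beyond \<open>v\<close>, past the
  last occurrence of \<open>r\<close>.\<close>

lemma not_sublist_r_f_t: "\<not> sublist r (f @ t)"
proof
  assume "sublist r (f @ t)"
  then obtain \<alpha> \<beta> where "f @ t = \<alpha> @ r @ \<beta>" by (auto simp: sublist_def)
  moreover obtain v0 where v0: "v = v0 @ r" by (rule obtain_v0)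
  moreover have "v0 @ r @ z @ t = v0 @ [a] @ f @ t" using Cons_f by simp
  ultimately have "w = (v0 @ [a] @ \<alpha>) @ r @ \<beta>" by simp
  from last_r[OF this] v0 show False by simp
qed

text \<open>The palindrome \<open>lps v\<close> is at least as long as the palindromic suffix
  \<open>r\<close>, hence ends with it, and by symmetry also starts with it.\<close>

lemma prefix_r_lps: "prefix r (lps v)"
proof -
  have "suffix r (lps v)"
    using suffix_length_suffix[OF suffix_r_v suffix_lps] length_le_lps[OF suffix_r_v palindrome_r]
    by simp
  then show ?thesis
    using suffix_palindrome_iff_prefix[OF palindrome_lps] palindrome_r by (metis palindrome_def)
qed

lemma prefix_y_snoc_v: "prefix (y @ [a]) v"
proof -
  have "prefix (h @ rev z @ r) (h @ rev z @ lps v)"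
    using prefix_r_lps by simp
  then show ?thesis unfolding y_snoc using v_eq by simp
qed

lemma prefix_y_v: "prefix y v"
  using prefix_y_snoc_v by (metis append_prefixD)

lemma rich_y: "rich y"
  using rich_w prefix_y_v by (metis rich_prefix rich_appendD1)

lemma sublist_r_v: "sublist r v"
  using suffix_r_v by simp

lemma length_v: "2 < length v"
  using length_r suffix_length_le[OF suffix_r_v] by simp

text \<open>The dichotomy behind the whole argument: no flexed palindrome exceeds \<open>r\<close>
  in length, so a longer palindromic suffix can only come from a standard step.\<close>

lemma lps_prefix_cases:
  assumes "prefix (k @ [b]) w" "2 \<le> length k"
  shows "length (lps (k @ [b])) \<le> length r \<or> k @ [b] = std_step k"
  using flexedI[OF assms] length_flexed_le by auto

lemma lpps_prefix:
  assumes "prefix k w" "sublist r k"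
  shows "lpps k = lps k"
proof (rule lpps_eq_lps)
  show "k \<noteq> []" using assms(2) length_r by auto
  show "lps k \<noteq> k" using not_in_palindromic_prefix assms palindrome_lps by metis
qed

lemma lps_std_prefix:
  assumes "prefix (k @ [b]) w" "sublist r k" "k @ [b] = std_step k"
  shows "lps (k @ [b]) = b # lps k @ [b]"
proof -
  have "k \<noteq> []" using assms(2) length_r by auto
  moreover have "prefix k w" using assms(1) by (rule append_prefixD)
  ultimately show ?thesis using lps_std_step assms lpps_prefix by metis
qed

text \<open>No longest palindromic suffix ending inside \<open>t\<close> reaches back to the last occurrence of \<open>r\<close>:
  a flexed one is too short, and a standard one gains a single letter on its left, so that it
  would have to start exactly at that \<open>r\<close> and end with a later one.\<close>

lemma length_lps_in_t:
  assumes "prefix t1 t" "t1 \<noteq> []"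
  shows "length (lps (v @ z @ t1)) \<le> length (f @ t1)"
  using assms
proof (induction t1 rule: rev_induct)
  case (snoc b t0)
  let ?k = "v @ z @ t0"
  let ?q = "lps (?k @ [b])"
  have p: "prefix (?k @ [b]) w" using snoc.prems by simp
  have rk: "sublist r ?k" using sublist_r_v by (simp add: sublist_append)
  from p length_v have "length ?q \<le> length r \<or> ?k @ [b] = std_step ?k"
    by (intro lps_prefix_cases) auto
  then show ?case
  proof
    assume "length ?q \<le> length r"
    then show ?thesis using length_r by simp
  next
    assume std: "?k @ [b] = std_step ?k"
    \<comment> \<open>The first letter of \<open>t\<close> is not a standard step, so the induction
      hypothesis is available for a nonempty \<open>t0\<close>.\<close>
    have "t0 \<noteq> []"
      using t_not_std std snoc.prems(1) by (cases t) auto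
    then have IH: "length (lps ?k) \<le> length (f @ t0)"
      using snoc.IH snoc.prems(1) by (metis append_prefixD)
    have q: "?q = b # lps ?k @ [b]" by (rule lps_std_prefix[OF p rk std])
    show ?thesis
    proof (rule ccontr)
      assume "\<not> ?thesis"
      with IH q have len: "length ?q = length (r @ z @ t0 @ [b])" using length_r by simp
      obtain v0 where v0: "v = v0 @ r" by (rule obtain_v0)
      have "suffix (r @ z @ t0 @ [b]) (?k @ [b])" using v0 by (simp add: suffix_def)
      with len have q': "?q = r @ z @ t0 @ [b]"
        using suffix_eq_length suffix_lps by metis
      then have "prefix r ?q" by simp
      then have "suffix r ?q"
        using palindrome_r by (metis suffix_palindrome_iff_prefix palindrome_lps palindrome_def)
      then have "suffix r ((tl r @ z @ t0) @ [b])"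
        using q' hd_Cons_tl_r length_r
          suffix_length_suffix[of r "?q" "(tl r @ z @ t0) @ [b]"]
        by (metis (no_types, lifting) append_Cons append_assoc length_append_singleton
            length_append suffix_ConsI suffix_order.refl add.commute length_Cons
            le_add1 add_Suc_right append_is_Nil_conv)
      then have "sublist r (f @ t0 @ [b])" by simp
      moreover have "prefix (f @ t0 @ [b]) (f @ t)" using snoc.prems(1) by simp
      ultimately show False
        using not_sublist_r_f_t by (meson prefix_imp_sublist sublist_order.order_trans)
    qed
  qed
qed simp

lemma suffix_lps_in_t:
  assumes "prefix t1 t" "t1 \<noteq> []"
  shows "suffix (lps (v @ z @ t1)) (f @ t1)"
proof -
  have "suffix (f @ t1) (v @ z @ t1)"
    using suffix_ConsD[OF suffix_Cons_f] by (metis append_assoc same_suffix_suffix)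
  then show ?thesis
    using suffix_length_suffix[OF suffix_lps] length_lps_in_t[OF assms] by blast
qed

lemma lps_in_t_fresh:
  assumes "prefix (t0 @ [b]) t"
  shows "\<not> sublist (lps (v @ z @ t0 @ [b])) (v @ z @ t0)"
proof -
  have "prefix ((v @ z @ t0) @ [b]) w" using assms by simp
  then have "rich ((v @ z @ t0) @ [b])" using rich_w rich_prefix by blast
  then show ?thesis unfolding rich_snoc by simp
qed

text \<open>Here \<open>P\<close> is any candidate for the reduced prefix. The last assumption says
  that the palindromes created in \<open>w\<close> while reading \<open>t\<close> are also new after
  \<open>P\<close>; verifying it is the main work in each case.\<close>

context
  fixes P :: "'a list"
  assumes rich_P: "rich P" and suffix_f_P: "suffix f P" and flexed_P: "flexed P \<subseteq> flexed w"
    and fresh: "\<And>t0 b. prefix (t0 @ [b]) t \<Longrightarrow> \<not> sublist (lps (v @ z @ t0 @ [b])) (P @ t0)"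
begin

text \<open>Through the common suffix \<open>f @ t0 @ [b]\<close> the palindrome found in
  \<open>w\<close> is a suffix here too, and a palindromic suffix without earlier occurrence is the
  longest.\<close>

lemma lps_replace:
  assumes "prefix (t0 @ [b]) t"
  shows "lps (P @ t0 @ [b]) = lps (v @ z @ t0 @ [b])"
proof -
  have "suffix (lps (v @ z @ t0 @ [b])) (f @ t0 @ [b])"
    using suffix_lps_in_t[OF assms] by simp
  moreover have "suffix (f @ t0 @ [b]) (P @ t0 @ [b])"
    using suffix_f_P by (simp only: same_suffix_suffix)
  ultimately have "suffix (lps (v @ z @ t0 @ [b])) ((P @ t0) @ [b])"
    unfolding append_assoc by (rule suffix_order.order_trans)
  from lps_eqI_fresh[OF this palindrome_lps fresh[OF assms]] show ?thesis by simp
qed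

lemma rich_replace: "prefix t1 t \<Longrightarrow> rich (P @ t1)"
proof (induction t1 rule: rev_induct)
  case (snoc b t0)
  then have "rich (P @ t0)" by (metis append_prefixD)
  moreover have "\<not> sublist (lps ((P @ t0) @ [b])) (P @ t0)"
    using fresh[OF snoc.prems] lps_replace[OF snoc.prems] by simp
  ultimately have "rich ((P @ t0) @ [b])" unfolding rich_snoc by blast
  then show ?case by simp
qed (use rich_P in simp)

text \<open>Positions in \<open>P\<close> are covered by assumption. Within \<open>t\<close> the
  longest palindromic suffixes agree, so a step that is standard in \<open>w\<close> would be
  standard here as well.\<close>

lemma flexed_replace: "flexed (P @ t) \<subseteq> flexed w"
proof
  fix q assume "q \<in> flexed (P @ t)"
  then obtain u b where ub: "q = lps (u @ [b])" "prefix (u @ [b]) (P @ t)" "2 \<le> length u"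
    "u @ [b] \<noteq> std_step u" by (rule flexedE)
  show "q \<in> flexed w"
  proof (cases "prefix (u @ [b]) P")
    case True
    show ?thesis
      using flexedI[OF True ub(3,4)] flexed_P unfolding ub(1)[symmetric] by (rule rev_subsetD)
  next
    case False
    with ub(2) obtain t1 where t1: "u @ [b] = P @ t1" "prefix t1 t" unfolding prefix_append by blast
    with False have "t1 \<noteq> []" by auto
    then obtain t0 c where "t1 = t0 @ [c]" by (metis append_butlast_last_id)
    with t1(1) have "u @ [b] = (P @ t0) @ [c]" by simp
    then have t0: "t1 = t0 @ [b]" "u = P @ t0" using \<open>t1 = t0 @ [c]\<close> by simp_all
    have t0b: "prefix (t0 @ [b]) t" using t1 t0 by simp
    let ?k = "v @ z @ t0"
    have p: "prefix (?k @ [b]) w" using t0b by simp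
    have q: "q = lps (?k @ [b])" using ub(1) t0(2) lps_replace[OF t0b] by simp
    have "?k @ [b] \<noteq> std_step ?k"
    proof
      assume std: "?k @ [b] = std_step ?k"
      \<comment> \<open>The longest palindromic suffixes before the step are known to agree only
        after at least one letter of \<open>t\<close>; the first letter of \<open>t\<close> is never
        a standard step in \<open>w\<close>.\<close>
      have "t0 \<noteq> []"
        using t_not_std std t0b by (cases t) auto
      then obtain s c where s: "t0 = s @ [c]" by (cases t0 rule: rev_cases) auto
      have "prefix (s @ [c]) t" using append_prefixD[OF t0b] s by simp
      then have "lps ?k = lps u" using lps_replace s t0(2) by simp
      moreover have "sublist r ?k" using sublist_r_v by (simp add: sublist_append)
      ultimately have "lps (u @ [b]) = b # lps u @ [b]"
        using lps_std_prefix[OF p _ std] q ub(1) by simp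
      from ub(4) std_stepI[OF this] show False ..
    qed
    then show ?thesis using flexedI[OF p] length_v q by simp
  qed
qed

end

subsection \<open>The two cases of the reduction\<close>

abbreviation reduces_to :: "'a list \<Rightarrow> bool" where
  "reduces_to w' \<equiv> rich w' \<and> flexed w' \<subseteq> flexed w \<and> occur w' r < occur w r \<and>
    length r - 1 \<le> length (longest_common_prefix w' w) \<and> length r - 1 \<le> length (lcs w' w)"

text \<open>Both words end with \<open>f @ t\<close>, and \<open>f\<close> alone has length at least
  \<open>length r - 1\<close>.\<close>

lemma length_lcs_replace:
  assumes "suffix f P"
  shows "length r - 1 \<le> length (lcs (P @ t) w)"
proof -
  have "suffix (f @ t) (P @ t)" using assms by (simp only: same_suffix_suffix)
  moreover have "suffix (f @ t) ((v @ z) @ t)"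
    using suffix_ConsD[OF suffix_Cons_f] by (simp only: same_suffix_suffix)
  ultimately have "length (f @ t) \<le> length (lcs (P @ t) w)"
    using length_le_lcs by (metis append_assoc)
  then show ?thesis by simp
qed

section \<open>The case of an earlier occurrence of \<open>r\<close>: shortening a complete
  return\<close>

text \<open>The complete return \<open>g\<close> is a palindrome ending with
  \<open>rev z @ r\<close>, so it starts with \<open>r @ z\<close>, and \<open>gb @ r @ z\<close> is
  itself a prefix of \<open>w\<close>. A palindrome created in \<open>t\<close> cannot straddle
  \<open>r @ z\<close>, because it does not contain \<open>r\<close>.\<close>

lemma reduces_at_complete_return:
  assumes g: "complete_return g r" and gb: "gb @ g = h @ rev z @ r"
  shows "reduces_to (gb @ r @ z @ t)"
proof -
  let ?P = "gb @ r @ z"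
  obtain v0 where v0: "v = v0 @ r" by (rule obtain_v0)
  obtain s where s: "s \<noteq> []" "g = s @ r" "prefix r g"
    using g by (auto simp: complete_return_iff)
  have pxr: "prefix (h @ rev z @ r) v" using prefix_y_snoc_v unfolding y_snoc .
  then have pw: "prefix (h @ rev z @ r) w" by simp
  have "suffix g (h @ rev z @ r)" by (rule suffixI) (rule gb[symmetric])
  then have "sublist g w" using pw sublist_prefix_trans suffix_imp_sublist by blast
  then have "rich g" using rich_w rich_sublist by blast
  then have pal_g: "palindrome g" using complete_return_palindrome palindrome_r g by blast
  \<comment> \<open>Otherwise, after reversal, \<open>g\<close> would be a prefix of
    \<open>r @ z\<close>, and its second \<open>r\<close> would come after the last occurrence of
    \<open>r\<close> in \<open>w\<close>.\<close>
  have "\<not> suffix g (rev z @ r)"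
  proof
    assume "suffix g (rev z @ r)"
    then have "prefix (rev g) (rev (rev z @ r))" by (simp only: suffix_to_prefix)
    then have "prefix g (r @ z)" using pal_g palindrome_r by (simp add: palindrome_def)
    then obtain c where c: "r @ z = s @ r @ c" using s(2) by (auto simp: prefix_def)
    have "w = v0 @ (r @ z) @ t" using v0 by simp
    then have "w = (v0 @ s) @ r @ (c @ t)" unfolding c by simp
    from last_r[OF this] v0 s(1) show False by simp
  qed
  then have "suffix (rev z @ r) g"
    using suffix_same_cases[of g "h @ rev z @ r" "rev z @ r"] \<open>suffix g (h @ rev z @ r)\<close>
    by (metis suffixI)
  then have "prefix (r @ z) g"
    using suffix_palindrome_iff_prefix[OF pal_g, of "rev z @ r"] palindrome_r
    by (simp add: palindrome_def)
  then have "prefix ?P (h @ rev z @ r)" unfolding gb[symmetric] by simp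
  then have Pv: "prefix ?P v" using pxr prefix_order.order_trans by blast
  then have Pw: "prefix ?P w" by simp
  have suf: "suffix f ?P" using Cons_f by (metis suffix_ConsD suffixI)
  have fresh: "\<not> sublist (lps (v @ z @ t0 @ [b])) (?P @ t0)" if t0: "prefix (t0 @ [b]) t" for t0 b
  proof
    let ?q = "lps (v @ z @ t0 @ [b])"
    assume "sublist ?q (?P @ t0)"
    then have "sublist ?q (gb @ (r @ z) @ t0)" by simp
    then show False
    proof (rule sublist_straddle)
      show "\<not> sublist ?q (gb @ r @ z)"
      proof
        assume "sublist ?q (gb @ r @ z)"
        moreover have "prefix (gb @ r @ z) (v @ z @ t0)" using Pv by simp
        ultimately show False
          using lps_in_t_fresh[OF t0] sublist_prefix_trans by blast
      qed
      show "\<not> sublist ?q ((r @ z) @ t0)"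
      proof
        assume "sublist ?q ((r @ z) @ t0)"
        moreover have "suffix ((r @ z) @ t0) (v @ z @ t0)" unfolding v0 by (simp add: suffix_def)
        ultimately show False
          using lps_in_t_fresh[OF t0] sublist_suffix_trans by blast
      qed
      assume "sublist (last gb # (r @ z) @ [hd t0]) ?q"
      moreover have "last gb # (r @ z) @ [hd t0] = [last gb] @ r @ (z @ [hd t0])" by simp
      ultimately have "sublist r ?q"
        by (metis sublist_appendI sublist_order.order_trans)
      moreover have "suffix ?q (f @ t0 @ [b])" using suffix_lps_in_t[OF t0] by simp
      moreover have "prefix (f @ t0 @ [b]) (f @ t)" using t0 by simp
      ultimately show False
        using not_sublist_r_f_t sublist_prefix_trans sublist_suffix_trans by blast
    qed
  qed
  have occ: "occur (?P @ t) r < occur w r"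
    unfolding occur_eq_card_occs
  proof (rule psubset_card_mono)
    \<comment> \<open>An occurrence starting beyond \<open>gb\<close> would reappear in
      \<open>w\<close> after the \<open>r\<close> that ends \<open>v\<close>.\<close>
    have len: "length \<alpha> \<le> length gb" if \<alpha>: "\<alpha> \<in> occs (?P @ t) r" for \<alpha>
    proof (rule ccontr)
      assume "\<not> ?thesis"
      moreover obtain \<beta> where \<beta>: "gb @ r @ z @ t = \<alpha> @ r @ \<beta>" using \<alpha> by (auto simp: occs_def)
      moreover from this have "prefix gb (\<alpha> @ r @ \<beta>)" by (metis prefixI)
      ultimately have "prefix gb \<alpha>"
        using prefix_length_prefix[of gb "\<alpha> @ r @ \<beta>" \<alpha>] by simp
      then obtain \<alpha>' where \<alpha>': "\<alpha> = gb @ \<alpha>'" by (auto simp: prefix_def)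
      with \<beta> have "r @ z @ t = \<alpha>' @ r @ \<beta>" by simp
      then have "w = (v0 @ \<alpha>') @ r @ \<beta>" using v0 by simp
      from last_r[OF this] v0 have "\<alpha>' = []" by simp
      with \<alpha>' \<open>\<not> length \<alpha> \<le> length gb\<close> show False by simp
    qed
    have "occs (?P @ t) r \<subseteq> occs w r"
    proof
      fix \<alpha> assume \<alpha>: "\<alpha> \<in> occs (?P @ t) r"
      have "prefix (\<alpha> @ r) (gb @ r)"
        using prefix_length_prefix[of "\<alpha> @ r" "?P @ t" "gb @ r"] \<alpha> len[OF \<alpha>]
        by (simp add: mem_occs_iff)
      moreover have "prefix (gb @ r) ?P" by simp
      ultimately have "prefix (\<alpha> @ r) w" using Pw prefix_order.order_trans by blast
      then show "\<alpha> \<in> occs w r" by (simp only: mem_occs_iff)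
    qed
    \<comment> \<open>This left context, that of the final \<open>r\<close> in
      \<open>gb @ g\<close>, makes the inclusion strict.\<close>
    moreover have "gb @ s \<in> occs w r"
      using pw unfolding gb[symmetric] s(2) by (simp only: mem_occs_iff append_assoc)
    moreover have "gb @ s \<notin> occs (?P @ t) r" using len[of "gb @ s"] s(1) by auto
    ultimately show "occs (?P @ t) r \<subset> occs w r" by blast
  qed simp
  have "length ?P \<le> length (longest_common_prefix (?P @ t) w)"
    using Pw by (intro length_le_longest_common_prefix) simp_all
  then have lcp: "length r - 1 \<le> length (longest_common_prefix (?P @ t) w)" by simp
  have richP: "rich ?P" using Pw rich_w rich_prefix by blast
  have "rich (?P @ t)"
    using rich_replace[OF richP suf flexed_prefix_mono[OF Pw] fresh] by simp
  moreover have "flexed (?P @ t) \<subseteq> flexed w"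
    using flexed_replace[OF richP suf flexed_prefix_mono[OF Pw] fresh] by simp
  ultimately show ?thesis using occ lcp length_lcs_replace[OF suf] by simp
qed

section \<open>The case of no earlier occurrence of \<open>r\<close>: closing
  \<open>y\<close>\<close>

text \<open>By richness, the step at which \<open>r\<close> is flexed is also the first place where
  \<open>r\<close> ends. When \<open>y\<close> does not contain \<open>r\<close>, that place is
  \<open>y @ [a]\<close>.\<close>

lemma y_snoc_not_std:
  assumes "\<not> sublist r y"
  shows "y @ [a] \<noteq> std_step y"
proof -
  obtain u b where ub: "r = lps (u @ [b])" "prefix (u @ [b]) w" "u @ [b] \<noteq> std_step u"
    using r_flexed by (rule flexedE)
  have r_u: "\<not> sublist r u"
    using rich_prefix[OF rich_w ub(2)] unfolding rich_snoc ub(1)[symmetric] by simp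
  have r_ub: "sublist r (u @ [b])"
    using suffix_lps[of "u @ [b]"] unfolding ub(1)[symmetric] by (rule suffix_imp_sublist)
  have "prefix (y @ [a]) w" using prefix_y_snoc_v by simp
  with ub(2) consider "prefix (u @ [b]) (y @ [a])" | "prefix (y @ [a]) (u @ [b])"
    using prefix_same_cases by blast
  then have "u @ [b] = y @ [a]"
  proof cases
    case 1
    with assms r_ub show ?thesis
      unfolding prefix_snoc using sublist_prefix_trans by blast
  next
    case 2
    have "sublist r (y @ [a])" unfolding y_snoc by (metis append_assoc sublist_append_leftI)
    with 2 r_u show ?thesis
      unfolding prefix_snoc using sublist_prefix_trans by blast
  qed
  with ub(3) show ?thesis by (metis append1_eq_conv)
qed

text \<open>One step of the descent. The first repetition forces \<open>lps k\<close> to end with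
  \<open>c # d\<close>, hence to start with \<open>rev d @ [c]\<close>. The second makes
  \<open>lps (k @ [b])\<close> longer than \<open>r\<close>, so the step is standard and
  \<open>b\<close> stands in front of \<open>lps k\<close>.\<close>

lemma sublist_rev_before:
  assumes "prefix (k @ [b]) w" "sublist r k" "suffix (c # d) k" "length r \<le> length d + 1"
    and "sublist d (butlast k) \<or> sublist (rev d) (butlast k)"
    and "sublist (d @ [b]) k \<or> sublist (b # rev d) k"
  shows "sublist (b # rev d @ [c]) k"
proof -
  have pk: "prefix k w" using assms(1) by (rule append_prefixD)
  have kne: "k \<noteq> []" using assms(3) by auto
  have k: "butlast k @ [last k] = k" using kne by (rule append_butlast_last_id)
  have "rich (butlast k @ [last k])" unfolding k using rich_prefix[OF rich_w pk] .
  from length_lps_gt[OF this _ assms(5)] have 1: "length d < length (lps k)"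
    unfolding k using suffix_ConsD[OF assms(3)] by simp
  have dk: "suffix (d @ [b]) (k @ [b])" using suffix_ConsD[OF assms(3)] by simp
  have "sublist (d @ [b]) k \<or> sublist (rev (d @ [b])) k" using assms(6) by simp
  from length_lps_gt[OF rich_prefix[OF rich_w assms(1)] dk this]
  have "length r < length (lps (k @ [b]))" using assms(4) by simp
  moreover have "2 \<le> length k"
    using sublist_length_le[OF assms(2)] length_r by simp
  ultimately have "k @ [b] = std_step k" using lps_prefix_cases[OF assms(1)] by auto
  from lps_std_prefix[OF assms(1,2) this] have "suffix ((b # lps k) @ [b]) (k @ [b])"
    using suffix_lps[of "k @ [b]"] by simp
  then have blk: "suffix (b # lps k) k" by (simp only: snoc_suffix_snoc)
  have "suffix (c # d) (lps k)"
    using suffix_length_suffix[OF assms(3) suffix_lps] 1 by simp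
  then have "prefix (rev (c # d)) (lps k)"
    using suffix_palindrome_iff_prefix[OF palindrome_lps] by blast
  then have "prefix (b # rev d @ [c]) (b # lps k)" by simp
  with blk show ?thesis
    using sublist_suffix_trans prefix_imp_sublist by blast
qed

text \<open>The step to \<open>hd t\<close> is not standard, so its palindrome has length at most
  \<open>length f + 1\<close>. By \<open>length_lps_gt\<close> this excludes an earlier
  \<open>f @ [hd t]\<close> in either direction.\<close>

lemma f_hd_t_first:
  assumes "t \<noteq> []"
  shows "\<not> sublist (f @ [hd t]) (v @ z)" "\<not> sublist (hd t # rev f) (v @ z)"
proof -
  have p: "prefix ((v @ z) @ [hd t]) w" using assms by (cases t) auto
  have "length (lps ((v @ z) @ [hd t])) \<le> length r"
    using lps_prefix_cases[OF p] t_not_std[OF assms] length_v by simp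
  moreover have "suffix (f @ [hd t]) ((v @ z) @ [hd t])"
    using suffix_ConsD[OF suffix_Cons_f] by (simp only: same_suffix_suffix)
  ultimately have "\<not> (sublist (f @ [hd t]) (v @ z) \<or> sublist (rev (f @ [hd t])) (v @ z))"
    using length_lps_gt[OF rich_prefix[OF rich_w p], of "f @ [hd t]"] length_f
    by (auto simp del: suffix_snoc snoc_suffix_snoc rev_append)
  then show "\<not> sublist (f @ [hd t]) (v @ z)" "\<not> sublist (hd t # rev f) (v @ z)"
    by simp_all
qed

text \<open>In the shortest prefix of \<open>w\<close> ending with the word or with its reversal,
  \<open>sublist_rev_before\<close> produces the opposite orientation still earlier. It applies
  because that prefix reaches beyond \<open>v @ z @ [hd t]\<close>, so \<open>f @ [hd t]\<close> and
  \<open>c # f\<close> have already occurred.\<close>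

lemma other_extension_not_sublist:
  assumes "t \<noteq> []" "sublist (c # f) y" "c \<noteq> a"
  shows "\<not> sublist (c # f @ [hd t]) w"
proof
  let ?b = "hd t"
  assume "sublist (c # f @ [?b]) w"
  have min: thesis if
    "\<And>k e. prefix (k @ [e]) w \<Longrightarrow>
      suffix (c # f @ [?b]) (k @ [e]) \<or> suffix (?b # rev f @ [c]) (k @ [e]) \<Longrightarrow>
      \<not> sublist (c # f @ [?b]) k \<Longrightarrow> \<not> sublist (?b # rev f @ [c]) k \<Longrightarrow> thesis" for thesis
  proof -
    obtain k e where ke: "prefix (k @ [e]) w" "suffix (c # f @ [?b]) (k @ [e])"
      "\<not> sublist (c # f @ [?b]) k"
      using \<open>sublist (c # f @ [?b]) w\<close> by (rule shortest_prefix_containing) simp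
    show thesis
    proof (cases "sublist (?b # rev f @ [c]) k")
      case True
      then obtain k' e' where ke': "prefix (k' @ [e']) k" "suffix (?b # rev f @ [c]) (k' @ [e'])"
        "\<not> sublist (?b # rev f @ [c]) k'"
        by (rule shortest_prefix_containing) simp
      have "prefix (k' @ [e']) w"
        using ke'(1) append_prefixD[OF ke(1)] by (rule prefix_order.order_trans)
      moreover have "\<not> sublist (c # f @ [?b]) k'"
        using ke(3) append_prefixD[OF ke'(1)] sublist_prefix_trans by blast
      ultimately show thesis using that ke'(2,3) by blast
    next
      case False
      then show thesis using that ke by blast
    qed
  qed
  obtain k e where ke: "prefix (k @ [e]) w"
    "suffix (c # f @ [?b]) (k @ [e]) \<or> suffix (?b # rev f @ [c]) (k @ [e])"
    "\<not> sublist (c # f @ [?b]) k" "\<not> sublist (?b # rev f @ [c]) k"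
    by (rule min)
  have first: "\<not> sublist (f @ [?b]) (v @ z)" "\<not> sublist (?b # rev f) (v @ z)"
    using f_hd_t_first[OF assms(1)] by auto
  have pvz: "prefix (v @ z) w" by simp
  have ends: "(e = ?b \<and> suffix (c # f) k) \<or> (e = c \<and> suffix (?b # rev f) k)"
    using ke(2) by (metis append_Cons snoc_suffix_snoc)
  \<comment> \<open>Neither orientation fits inside \<open>v @ z\<close>, since each contains
    \<open>f @ [?b]\<close> or its reversal, and the \<open>f\<close> that ends \<open>v @ z\<close>
    is preceded by \<open>a\<close> instead of \<open>c\<close>.\<close>
  have "prefix ((v @ z) @ [?b]) k"
  proof -
    have pk: "prefix k w" using ke(1) by (rule append_prefixD)
    have nk: "\<not> prefix (k @ [e]) (v @ z)"
    proof
      assume *: "prefix (k @ [e]) (v @ z)"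
      have "sublist (f @ [?b]) (k @ [e]) \<or> sublist (?b # rev f) (k @ [e])"
        using ke(2)
      proof
        assume "suffix (c # f @ [?b]) (k @ [e])"
        then show ?thesis using suffix_imp_sublist[OF suffix_ConsD] by metis
      next
        assume *: "suffix (?b # rev f @ [c]) (k @ [e])"
        have "prefix (?b # rev f) (?b # rev f @ [c])" by simp
        from sublist_suffix_trans[OF prefix_imp_sublist[OF this] *] show ?thesis ..
      qed
      then have "sublist (f @ [?b]) (v @ z) \<or> sublist (?b # rev f) (v @ z)"
        using sublist_prefix_trans[OF _ *] by metis
      with first show False by metis
    qed
    have vzk: "prefix (v @ z) k"
      using prefix_same_cases[OF ke(1) pvz] nk by (auto simp only: prefix_snoc)
    moreover have "k \<noteq> v @ z"
    proof
      assume k: "k = v @ z"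
      from ends show False
      proof
        assume "e = ?b \<and> suffix (c # f) k"
        then have "c # f = a # f"
          using suffix_Cons_f k suffix_eq_length[of "c # f" k "a # f"] by simp
        with assms(3) show False by simp
      next
        assume "e = c \<and> suffix (?b # rev f) k"
        with first k show False by simp
      qed
    qed
    ultimately obtain k1 where k1: "k = (v @ z) @ k1" "k1 \<noteq> []" by (auto simp: prefix_def)
    then obtain d ds where d: "k = (v @ z) @ d # ds" by (cases k1) auto
    with pk have "prefix (d # ds) t" by simp
    then have "d = ?b" by (cases t) auto
    with d show ?thesis by simp
  qed
  then obtain k0 where k0: "k = ((v @ z) @ [?b]) @ k0" by (auto simp: prefix_def)
  have rk: "sublist r k"
    using sublist_r_v unfolding k0 append_assoc by (simp add: sublist_append)
  have fb: "sublist (f @ [?b]) k"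
  proof -
    have "suffix (f @ [?b]) ((v @ z) @ [?b])"
      using suffix_ConsD[OF suffix_Cons_f] by (simp only: same_suffix_suffix)
    then have "sublist (f @ [?b]) ((v @ z) @ [?b])" by (rule suffix_imp_sublist)
    then show ?thesis unfolding k0 using sublist_append by blast
  qed
  have cf: "sublist (c # f) (butlast k)"
  proof -
    have "prefix y (butlast k)"
      using prefix_y_v unfolding k0 by (simp add: butlast_append)
    then show ?thesis using assms(2) sublist_prefix_trans by blast
  qed
  then have cfk: "sublist (c # f) k"
    using sublist_butlast sublist_order.order_trans by blast
  have ff: "sublist f (butlast k)"
    by (rule suffix_sublist_trans[OF _ cf]) (simp add: suffix_ConsI)
  from ends show False
  proof
    assume "e = ?b \<and> suffix (c # f) k"
    then have "sublist (?b # rev f @ [c]) k"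
      using sublist_rev_before[of k ?b c f] ke(1) rk length_f ff fb by blast
    with ke(4) show False ..
  next
    assume "e = c \<and> suffix (?b # rev f) k"
    \<comment> \<open>The same step with \<open>rev f\<close> in the middle and the roles of
      \<open>c\<close> and \<open>?b\<close> exchanged.\<close>
    then have "sublist (c # rev (rev f) @ [?b]) k"
      using sublist_rev_before[of k c ?b "rev f"] ke(1) rk length_f ff cfk
      by (simp only: rev_rev_ident length_rev) blast
    with ke(3) show False by simp
  qed
qed

text \<open>The frame shared by both positions of \<open>P\<close> relative to \<open>y\<close>. As
  neither \<open>P\<close> nor \<open>f @ t\<close> contains \<open>r\<close>, and \<open>r\<close>
  is too short to straddle \<open>f\<close>, the reduced word contains no \<open>r\<close> at
  all.\<close>

lemma reduces_to_replace:
  assumes "P = u @ f" "rich P" "flexed P \<subseteq> flexed w" "\<not> sublist r P"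
    and lcp: "length r - 1 \<le> length (longest_common_prefix (P @ t) w)"
    and P: "\<And>t0 b. prefix (t0 @ [b]) t \<Longrightarrow> \<not> sublist (lps (v @ z @ t0 @ [b])) P"
    and straddle: "t \<noteq> [] \<Longrightarrow> u \<noteq> [] \<Longrightarrow> \<not> sublist (last u # f @ [hd t]) w"
  shows "reduces_to (P @ t)"
proof -
  have suf: "suffix f P" using assms(1) by (rule suffixI)
  have fresh: "\<not> sublist (lps (v @ z @ t0 @ [b])) (P @ t0)" if t0: "prefix (t0 @ [b]) t" for t0 b
  proof
    let ?q = "lps (v @ z @ t0 @ [b])"
    assume "sublist ?q (P @ t0)"
    then have "sublist ?q (u @ f @ t0)" using assms(1) by simp
    then show False
    proof (rule sublist_straddle)
      show "\<not> sublist ?q (u @ f)" using P[OF t0] assms(1) by simp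
      show "\<not> sublist ?q (f @ t0)"
      proof
        assume "sublist ?q (f @ t0)"
        moreover have "suffix (f @ t0) ((v @ z) @ t0)"
          using suffix_ConsD[OF suffix_Cons_f] by (simp only: same_suffix_suffix)
        ultimately have "sublist ?q ((v @ z) @ t0)" by (rule sublist_suffix_trans)
        with lps_in_t_fresh[OF t0] show False by simp
      qed
      assume *: "u \<noteq> []" "t0 \<noteq> []" "sublist (last u # f @ [hd t0]) ?q"
      have "hd t0 = hd t" "t \<noteq> []" using t0 *(2) by (auto simp: prefix_def)
      moreover have "prefix (v @ z @ t0 @ [b]) w" using t0 by simp
      then have "sublist ?q w"
        using sublist_prefix_trans suffix_imp_sublist[OF suffix_lps] by blast
      ultimately show False using straddle * sublist_order.order_trans by metis
    qed
  qed
  have "\<not> sublist r (u @ f @ t)"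
  proof
    assume "sublist r (u @ f @ t)"
    then show False
    proof (rule sublist_straddle)
      assume "sublist (last u # f @ [hd t]) r"
      from sublist_length_le[OF this] length_f show False by simp
    qed (use assms(1,4) not_sublist_r_f_t in auto)
  qed
  then have "occs (P @ t) r = {}" using assms(1) by (simp add: occs_eq_empty_iff)
  moreover have "sublist r w" using sublist_r_v by (simp add: sublist_append)
  then have "occs w r \<noteq> {}" using occs_eq_empty_iff by blast
  ultimately have "occur (P @ t) r < occur w r"
    by (simp add: occur_eq_card_occs card_gt_0_iff)
  moreover have "rich (P @ t)"
    using rich_replace[OF assms(2) suf assms(3) fresh] by simp
  moreover have "flexed (P @ t) \<subseteq> flexed w"
    by (rule flexed_replace[OF assms(2) suf assms(3) fresh])
  ultimately show ?thesis using lcp length_lcs_replace[OF suf] by blast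
qed

text \<open>The first occurrence would complete a standard step with \<open>lpps k = lps y\<close>.
  If \<open>k\<close> were shorter than \<open>y\<close>, then \<open>lps y\<close> would be
  followed by a letter inside \<open>y\<close>; at \<open>k = y\<close> the next letter of
  \<open>w\<close> is \<open>a\<close>; if \<open>k\<close> were longer,
  \<open>lps k = lps y\<close> would be followed by \<open>a\<close> inside
  \<open>k\<close>.\<close>

lemma std_closure_not_sublist:
  assumes "y = u @ e # lps y" "e \<noteq> a" "length r < length (lps y) + 2"
  shows "\<not> sublist (e # lps y @ [e]) w"
proof
  let ?p = "lps y"
  assume "sublist (e # ?p @ [e]) w"
  then obtain k b where kb: "prefix (k @ [b]) w" "suffix (e # ?p @ [e]) (k @ [b])"
    "\<not> sublist (e # ?p @ [e]) k"
    by (rule shortest_prefix_containing) simp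
  from kb(2) have "suffix ((e # ?p) @ [e]) (k @ [b])" by (simp only: append_Cons)
  then have b: "b = e" and epk: "suffix (e # ?p) k" unfolding snoc_suffix_snoc by blast+
  have "palindrome (e # ?p @ [e])" using palindrome_lps[of y] by (simp add: palindrome_def)
  from lps_eqI_fresh[OF kb(2) this kb(3)] have lps: "lps (k @ [b]) = e # ?p @ [e]" .
  have "2 \<le> length k"
    using suffix_length_le[OF epk] assms(3) length_r by simp
  then have "k @ [b] = std_step k"
    using lps_prefix_cases[OF kb(1)] lps assms(3) by auto
  moreover have "k \<noteq> []" using epk by auto
  ultimately have "b # lpps k @ [b] = e # ?p @ [e]" using lps_std_step lps by metis
  then have lpps: "lpps k = ?p" by simp
  have pk: "prefix k w" using kb(1) by (rule append_prefixD)
  have pya: "prefix (y @ [a]) w" using prefix_y_snoc_v by simp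
  then have py: "prefix y w" by (rule append_prefixD)
  have ky: "k \<noteq> y"
  proof
    assume "k = y"
    then have "k @ [b] = y @ [a]"
      by (intro prefix_eq_length[OF kb(1) pya]) simp
    with b assms(2) show False by simp
  qed
  from prefix_same_cases[OF pk py] show False
  proof
    assume "prefix k y"
    with ky obtain d ds where d: "y = k @ d # ds"
      by (metis append_Nil2 neq_Nil_conv prefix_def)
    moreover obtain k' where "k = k' @ ?p" using suffix_ConsD[OF epk] by (auto simp: suffix_def)
    ultimately have "y = k' @ (?p @ [d]) @ ds" by (metis append_Cons append_Nil append_assoc)
    then have "sublist (?p @ [d]) y" by (metis sublist_appendI)
    with rich_lps_snoc_not_sublist[OF rich_y] show False by blast
  next
    assume "prefix y k"
    with ky obtain d ds where d: "k = y @ d # ds"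
      by (metis append_Nil2 neq_Nil_conv prefix_def)
    then have "prefix (y @ [d]) k" by simp
    moreover from this have "prefix (y @ [d]) w" using pk prefix_order.order_trans by blast
    then have "y @ [d] = y @ [a]" by (intro prefix_eq_length[OF _ pya]) simp_all
    ultimately have yak: "prefix (y @ [a]) k" by (simp only:)
    have "sublist r (y @ [a])" unfolding y_snoc by (metis append_assoc sublist_append_leftI)
    then have "sublist r k" using yak by (rule sublist_prefix_trans)
    then have "lps k = ?p" using lpps_prefix[OF pk] lpps by simp
    moreover have "suffix (?p @ [a]) (y @ [a])"
      unfolding snoc_suffix_snoc using suffix_lps by blast
    then have "sublist (?p @ [a]) k"
      using sublist_prefix_trans[OF suffix_imp_sublist yak] by blast
    ultimately show False using rich_lps_snoc_not_sublist rich_prefix[OF rich_w pk] by metis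
  qed
qed

text \<open>The letter before \<open>f\<close> in \<open>P\<close> differs from \<open>a\<close>,
  since otherwise \<open>r @ z\<close> would occur in \<open>P\<close>. Hence
  \<open>other_extension_not_sublist\<close> rules out straddling.\<close>

lemma reduces_in_closure_prefix:
  assumes "\<not> sublist r y" "suffix f P" "prefix P y"
  shows "reduces_to (P @ t)"
proof -
  obtain u where u: "P = u @ f" using assms(2) by (auto simp: suffix_def)
  have Pv: "prefix P v" using assms(3) prefix_y_v by (rule prefix_order.order_trans)
  then have Pw: "prefix P w" by simp
  have r_P: "\<not> sublist r P" using assms(1,3) sublist_prefix_trans by blast
  show ?thesis
  proof (rule reduces_to_replace[OF u])
    show "rich P" using rich_w Pw by (rule rich_prefix)
    show "flexed P \<subseteq> flexed w" using Pw by (rule flexed_prefix_mono)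
    show "\<not> sublist r P" by (rule r_P)
    have "length P \<le> length (longest_common_prefix (P @ t) w)"
      using Pw by (intro length_le_longest_common_prefix) simp_all
    then show "length r - 1 \<le> length (longest_common_prefix (P @ t) w)"
      using u length_f by simp
    show "\<not> sublist (lps (v @ z @ t0 @ [b])) P" if t0: "prefix (t0 @ [b]) t" for t0 b
    proof
      assume "sublist (lps (v @ z @ t0 @ [b])) P"
      moreover have "prefix P (v @ z @ t0)" using Pv by simp
      ultimately show False using lps_in_t_fresh[OF t0] sublist_prefix_trans by blast
    qed
    show "\<not> sublist (last u # f @ [hd t]) w" if "t \<noteq> []" "u \<noteq> []"
    proof (rule other_extension_not_sublist[OF that(1)])
      have "P = butlast u @ (last u # f)"
        using u that(2) append_butlast_last_id[of u] by (metis append_Cons append_Nil append_assoc)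
      then have lf: "sublist (last u # f) P" by (metis sublist_append_leftI)
      then show "sublist (last u # f) y" using assms(3) by (rule sublist_prefix_trans)
      show "last u \<noteq> a"
      proof
        assume "last u = a"
        with lf have "sublist (r @ z) P" by (simp only: Cons_f)
        with r_P sublist_order.order_trans[OF sublist_append_rightI[of r z]] show False by blast
      qed
    qed
  qed
qed

text \<open>Beyond \<open>y\<close> the word \<open>P\<close> follows the standard extension, which
  adds no flexed palindromes. If \<open>e\<close> is its first letter, each new palindrome contains
  \<open>e # lps y @ [e]\<close>, a word missing from \<open>w\<close>, which continues
  \<open>y\<close> with a different letter.\<close>

lemma reduces_in_closure_beyond:
  assumes r_y: "\<not> sublist r y" and P: "prefix P (pc y)" "suffix f P" "\<not> prefix P y"
    and minimal: "\<And>u. prefix u (pc y) \<Longrightarrow> suffix f u \<Longrightarrow> length P \<le> length u"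
  shows "reduces_to (P @ t)"
proof -
  let ?p = "lps y"
  obtain u where u: "y = u @ ?p" using suffix_lps[of y] by (auto simp only: suffix_def)
  have pc: "pc y = y @ rev u" using u by (rule pc_eq)
  from P(1,3) obtain d where d: "P = y @ d" "prefix d (rev u)"
    unfolding pc prefix_append by blast
  with P(3) have "d \<noteq> []" by auto
  with d(2) obtain e u0 where "rev u = e # u0" by (cases "rev u") auto
  then obtain u1 where u1: "u = u1 @ [e]" by (metis rev_eq_Cons_iff)
  have y: "y = u1 @ e # ?p" using u u1 by (metis append_Cons append_Nil append_assoc)
  have "?p \<noteq> y" using arg_cong[OF y, of length] by auto
  then have lpps: "lpps y = ?p" using y by (intro lpps_eq_lps) auto
  have "y = u1 @ e # lpps y" unfolding lpps by (rule y)
  then have "std_step y = y @ [e]" by (rule std_step_eq)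
  then have ea: "e \<noteq> a" using y_snoc_not_std[OF r_y] by auto
  \<comment> \<open>Write \<open>r = a # s @ [a]\<close>. Then \<open>s\<close> is a palindromic
    suffix of \<open>y\<close> preceded by \<open>a\<close>, whereas \<open>?p\<close> is preceded
    by \<open>e\<close>, so \<open>s\<close> is strictly shorter than \<open>?p\<close>.\<close>
  have len_p: "length r < length ?p + 2"
  proof -
    define s where "s = tl (butlast r)"
    have bl: "butlast r = a # s"
      unfolding s_def using length_r by (cases r) auto
    then have "a # s @ [a] = r" using butlast_snoc_r by simp
    then have "palindrome s"
      using palindrome_r palindrome_enclose[of "[a]" s] by simp
    have sa: "suffix (a # s) y" unfolding bl[symmetric] by (simp add: suffix_def)
    then have s: "suffix s y" by (rule suffix_ConsD)
    have "length s \<le> length ?p" using length_le_lps[OF s \<open>palindrome s\<close>] .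
    moreover have "length s \<noteq> length ?p"
    proof
      assume "length s = length ?p"
      moreover have "suffix (e # ?p) y" using y by (rule suffixI)
      ultimately have "a # s = e # ?p" using suffix_eq_length[OF sa] by simp
      with ea show False by simp
    qed
    ultimately show ?thesis using arg_cong[OF bl, of length] length_r by simp
  qed
  have epe: "\<not> sublist (e # ?p @ [e]) w"
    using std_closure_not_sublist[OF y ea len_p] .
  \<comment> \<open>The closure has \<open>f\<close> directly after \<open>u\<close>, so the
    shortest candidate \<open>P\<close> is no longer than \<open>u @ f\<close>.\<close>
  have "pc y = u @ rev y"
  proof -
    have "rev y = ?p @ rev u"
      using arg_cong[OF u, of rev] palindrome_lps[of y] by (simp add: palindrome_def)
    then show ?thesis unfolding pc using u by (metis append_assoc)
  qed
  also have "rev y = f @ rev h" using rev_f by (simp add: rev_butlast_r)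
  finally have pc2: "pc y = (u @ f) @ rev h" by simp
  have "prefix (u @ f) (pc y)" unfolding pc2 by simp
  from minimal[OF this] prefix_length_prefix[OF P(1) this]
  have Puf: "prefix P (u @ f)" "length P \<le> length (u @ f)" by (simp_all add: suffix_def)
  have "P = u @ ?p @ d" unfolding d(1) using u by (metis append_assoc)
  with Puf have pf: "prefix (?p @ d) f" by simp
  obtain d' where d': "d = e # d'"
    using \<open>d \<noteq> []\<close> d(2) u1 by (cases d) auto
  obtain u' where u': "P = u' @ f" using P(2) by (auto simp: suffix_def)
  \<comment> \<open>A shorter \<open>u'\<close> would place \<open>?p\<close>, a prefix of
    \<open>f\<close>, inside \<open>y\<close> with a letter after it.\<close>
  have "u' = u"
  proof (rule ccontr)
    assume "u' \<noteq> u"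
    have "length u' < length u"
    proof (rule ccontr)
      assume "\<not> length u' < length u"
      with Puf(2) u' have "length u' = length u" by simp
      moreover have "prefix u' (u @ f)" using Puf(1) u' append_prefixD by blast
      ultimately have "u' = u" using prefix_eq_length[of u' "u @ f" u] by simp
      with \<open>u' \<noteq> u\<close> show False ..
    qed
    then have len: "length (u' @ ?p) < length y" using arg_cong[OF u, of length] by simp
    have "prefix (u' @ ?p) P" unfolding u' using append_prefixD[OF pf] by simp
    moreover have "prefix y P" unfolding d(1) by simp
    ultimately have "prefix (u' @ ?p) y" using prefix_length_prefix len by (metis less_imp_le)
    with len obtain c cs where "y = (u' @ ?p) @ c # cs"
      by (metis append_Nil2 less_irrefl neq_Nil_conv prefix_def)
    then have "y = u' @ (?p @ [c]) @ cs" by (metis append_Cons append_Nil append_assoc)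
    then have "sublist (?p @ [c]) y" by (metis sublist_appendI)
    with rich_lps_snoc_not_sublist[OF rich_y] show False by blast
  qed
  with u' have uf: "P = u @ f" by simp
  have new: "sublist (e # ?p @ [e]) q" if "palindrome q" "sublist q P" "\<not> sublist q y" for q
  proof (rule new_palindrome_std_extension[OF rich_y])
    show "y = [] @ rev (e # rev u1) @ ?p" using u u1 by simp
    show "prefix d (e # rev u1)" using d(2) u1 by simp
    show "sublist q (y @ d)" using that(2) d(1) by simp
  qed (rule that)+
  from d(2) obtain d2 where "rev u = d @ d2" by (auto simp: prefix_def)
  then have "u = rev d2 @ rev d" by (metis rev_append rev_rev_ident)
  with u have ext: "y = rev d2 @ rev d @ ?p" by (metis append_assoc)
  have yw: "prefix y w" using prefix_y_v by simp
  show ?thesis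
  proof (rule reduces_to_replace[OF uf])
    show "rich P" unfolding d(1) using rich_std_extension[OF rich_y ext] by blast
    show "flexed P \<subseteq> flexed w"
      unfolding d(1) using flexed_std_extension[OF rich_y ext] flexed_prefix_mono[OF yw] by blast
    show "\<not> sublist r P"
    proof
      assume "sublist r P"
      from new[OF palindrome_r this r_y] sublist_length_le have "length (e # ?p @ [e]) \<le> length r"
        by blast
      with len_p show False by simp
    qed
    have "length y \<le> length (longest_common_prefix (P @ t) w)"
      using yw by (intro length_le_longest_common_prefix) (simp_all add: d(1))
    then show "length r - 1 \<le> length (longest_common_prefix (P @ t) w)" by simp
    show "\<not> sublist (lps (v @ z @ t0 @ [b])) P" if t0: "prefix (t0 @ [b]) t" for t0 b
    proof
      let ?q = "lps (v @ z @ t0 @ [b])"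
      assume *: "sublist ?q P"
      have "prefix y (v @ z @ t0)" using prefix_y_v by simp
      then have "\<not> sublist ?q y" using lps_in_t_fresh[OF t0] sublist_prefix_trans by blast
      from new[OF palindrome_lps * this] have "sublist (e # ?p @ [e]) ?q" .
      moreover have "prefix (v @ z @ t0 @ [b]) w" using t0 by simp
      then have "sublist ?q w"
        using sublist_prefix_trans suffix_imp_sublist[OF suffix_lps] by blast
      ultimately show False using epe sublist_order.order_trans by blast
    qed
    show "\<not> sublist (last u # f @ [hd t]) w"
    proof
      assume "sublist (last u # f @ [hd t]) w"
      \<comment> \<open>Here \<open>u\<close> ends with \<open>e\<close>, and \<open>f\<close>
        starts with \<open>?p @ [e]\<close>.\<close>
      moreover have "prefix (e # ?p @ [e]) (last u # f @ [hd t])"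
      proof -
        from pf obtain c where "f = ?p @ (e # d') @ c"
          unfolding d' by (auto simp only: prefix_def append_assoc)
        then have "last u # f @ [hd t] = (e # ?p @ [e]) @ d' @ c @ [hd t]"
          unfolding u1 by (simp only: last_snoc append_assoc append_Cons append_Nil)
        then show ?thesis by (rule prefixI)
      qed
      ultimately show False
        using epe prefix_imp_sublist sublist_order.order_trans by blast
    qed
  qed
qed

section \<open>Evaluating the definition of the reduced word\<close>

lemma reduces_to_rdcWrd:
  assumes "parse w r = (v, z, t)"
  shows "reduces_to (rdcWrd w r)"
proof -
  have w: "w = h @ rev z @ lps v @ z @ t" using v_eq by (metis append_assoc)
  have h: "(THE h'. w = h' @ rev z @ lps v @ z @ t) = h"
    using w by (intro the_equality) (metis append_same_eq)+
  define x where "x = h @ rev z"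
  have y: "y = x @ butlast r" unfolding x_def by simp
  define P where "P = (if sublist r y
    then let g = (THE g. complete_return g r \<and> suffix g (h @ rev z @ r));
             g' = (THE g'. g' @ g = h @ rev z @ r)
         in g' @ r @ z
    else (ARG_MIN length u. prefix u (pc y) \<and> suffix f u))"
  have rdc: "rdcWrd w r = P @ t"
    unfolding rdcWrd_def rdcPrf_def assms Let_def prod.case h P_def ..
  show ?thesis
  proof (cases "sublist r y")
    case True
    have "r \<noteq> []" using length_r by auto
    from True this obtain g where g: "complete_return g r" "suffix g (x @ r)"
      unfolding y by (rule ex_complete_return)
    have the_g: "(THE g. complete_return g r \<and> suffix g (h @ rev z @ r)) = g"
    proof (rule the_equality)
      show "complete_return g r \<and> suffix g (h @ rev z @ r)" using g by (simp add: x_def)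
    next
      fix g1 assume "complete_return g1 r \<and> suffix g1 (h @ rev z @ r)"
      then have "complete_return g1 r" "suffix g1 (x @ r)" by (simp_all add: x_def)
      then show "g1 = g" using g by (rule complete_return_suffix_unique)
    qed
    obtain g' where g': "h @ rev z @ r = g' @ g" using g(2) by (auto simp: x_def suffix_def)
    have the_g': "(THE g'. g' @ g = h @ rev z @ r) = g'"
      unfolding g' by simp
    have "P = g' @ r @ z" unfolding P_def using True the_g the_g' by (simp add: Let_def)
    then show ?thesis
      using reduces_at_complete_return[OF g(1) g'[symmetric]] unfolding rdc by simp
  next
    case False
    let ?U = "\<lambda>u. prefix u (pc y) \<and> suffix f u"
    \<comment> \<open>The word \<open>u @ f\<close> is a prefix of the closure ending with
      \<open>f\<close>, so the minimum is taken over a nonempty set.\<close>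
    obtain u where u: "y = u @ lps y" using suffix_lps[of y] by (auto simp only: suffix_def)
    have "rev y = lps y @ rev u"
      using arg_cong[OF u, of rev] palindrome_lps[of y] by (simp add: palindrome_def)
    then have "pc y = u @ rev y" using pc_eq[OF u] u by (metis append_assoc)
    also have "rev y = f @ rev h" using rev_f by (simp add: rev_butlast_r)
    finally have "?U (u @ f)" by (simp add: suffix_def)
    from arg_min_nat_lemma[of ?U, OF this, of length]
    have P: "?U P" "\<And>u. ?U u \<Longrightarrow> length P \<le> length u"
      unfolding P_def using False by auto
    show ?thesis
    proof (cases "prefix P y")
      case True
      then show ?thesis
        unfolding rdc using reduces_in_closure_prefix[OF False] P(1) by blast
    next
      case np: False
      then show ?thesis
        unfolding rdc using reduces_in_closure_beyond[OF False] P by blast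
    qed
  qed
qed

end

theorem theorem4p12:
  fixes w r :: "'a::finite list"
  assumes "(w, r) \<in> \<Gamma>"
  shows "rich (rdcWrd w r) \<and>
    flexed (rdcWrd w r) \<subseteq> flexed w \<and>
    occur (rdcWrd w r) r < occur w r \<and>
    length (longest_common_prefix (rdcWrd w r) w) \<ge> length r - 1 \<and>
    length (lcs (rdcWrd w r) w) \<ge> length r - 1"
proof -
  from assms have \<Gamma>: "rich w" "2 < length r" "r \<in> flexed w" "\<not> sublist r (lpp w)"
    "\<And>q. q \<in> flexed w \<Longrightarrow> length q \<le> length r"
    by (auto simp: \<Gamma>_def)
  obtain u b where ub: "r = lps (u @ [b])" "prefix (u @ [b]) w" using \<Gamma>(3) by (rule flexedE)
  have "sublist r w"
    unfolding ub(1) using ub(2) sublist_prefix_trans suffix_imp_sublist[OF suffix_lps] by blast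
  with \<Gamma>(1) obtain v z t where parse: "parse w r = (v, z, t)" and w: "w = v @ z @ t"
    and r_v: "suffix r v"
    and last: "\<And>\<alpha> \<beta>. w = \<alpha> @ r @ \<beta> \<Longrightarrow> length (\<alpha> @ r) \<le> length v"
    and max: "v @ z = MaxStdExt w v"
    by (rule parse_eq) blast
  \<comment> \<open>Every palindromic prefix of \<open>w\<close> is a prefix of
    \<open>lpp w\<close>, which does not contain \<open>r\<close>.\<close>
  have np: "\<not> sublist r k" if "prefix k w" "palindrome k" for k
    using \<Gamma>(4) prefix_length_prefix[OF that(1) prefix_lpp length_le_lpp[OF that]]
      sublist_prefix_trans by blast
  have v: "v \<noteq> []" "sublist r v" using r_v \<Gamma>(2) by auto
  have pv: "prefix v w" unfolding w by simp
  have "v @ z \<in> StdExts v" unfolding max using pv by (rule MaxStdExt_in_StdExts)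
  then obtain j where j: "v @ z = StdExt v j" by (auto simp: StdExts_def)
  have "prefix (StdExt v j) w" unfolding j[symmetric] w by simp
  from StdExt_decomp[OF v np this] obtain h where h: "v = h @ rev z @ lps v"
    unfolding j[symmetric] by auto
  interpret reduction v z t r h
  proof
    show "palindrome r" unfolding ub(1) by (rule palindrome_lps)
    \<comment> \<open>A standard step with the letter \<open>hd t\<close> would give a longer
      standard extension of \<open>v\<close> that is still a prefix of \<open>w\<close>.\<close>
    show "(v @ z) @ [hd t] \<noteq> std_step (v @ z)" if "t \<noteq> []"
    proof
      assume "(v @ z) @ [hd t] = std_step (v @ z)"
      moreover have "std_step (v @ z) \<in> StdExts v"
        using \<open>v @ z \<in> StdExts v\<close> by (rule StdExts_step)
      ultimately have *: "(v @ z) @ [hd t] \<in> StdExts v" by simp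
      have "prefix ((v @ z) @ [hd t]) w" unfolding w using that by (cases t) auto
      from length_le_MaxStdExt[OF pv * this] show False unfolding max[symmetric] by simp
    qed
  qed (use \<Gamma> r_v h last np w in \<open>simp_all\<close>)
  show ?thesis using reduces_to_rdcWrd parse unfolding w by blast
qed

end
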